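(* Let $f:\mathbb{R}^n\to\mathbb{R}$ be convex and three times differentiable with $\|D^3f(x)-D^3f(y)\|\le L_f\|x-y\|$ for all $x,y\in\mathbb{R}^n$, let $\psi:\mathbb{R}^n\to\mathbb{R}\cup\{+\infty\}$ be a simple convex function, and let $\tilde f=f+\psi$ have a minimizer $x^*$. Let $x_0\in\mathrm{dom}\,\psi$ and suppose that $\max\{\|x-x^*\| : \tilde f(x)\le\tilde f(x_0)\}\le R_0$ with $R_0\in(0,+\infty)$. Call the iterations of Algorithm 1 inner iterations (Algorithms 1 and 2 are described in the context). Then Algorithm 2 needs at most $\mathcal{O}\left(|\log_{1.2}(\epsilon)|\,\epsilon^{-1/3}\right)$ inner iterations to generate $\bar x$ such that $$\min\{\|\nabla\tilde f(\bar x)\|,\ \tilde f(\bar x)-\tilde f(x^* )\}\le\epsilon.$$ In fact, an inner iteration complexity bound of the same order holds for the generation of $\bar x$ such that $\|\nabla\tilde f(\bar x)\|\le\epsilon$.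
   Context: $\|\cdot\|$ is the Euclidean norm on $\mathbb{R}^n$ and the induced norm on matrices and tensors. $\partial$ denotes the convex subdifferential; $\partial\tilde f(x)=\nabla f(x)+\partial\psi(x)$, and $\nabla\tilde f(x)$ denotes a chosen element of $\partial\tilde f(x)$. Models. $\Phi_x(y)=f(x)+\sum_{i=1}^3\frac1{i!}D^if(x)[y-x]^i$; for $M>0$, $\Omega_{x,M}(y)=\Phi_x(y)+\frac M8\|y-x\|^4$ and $\tilde\Omega_{x,M}=\Omega_{x,M}+\psi$. Also $\rho_x(y)=\frac12\langle\nabla^2f(x)(y-x),y-x\rangle+\frac M8\|y-x\|^4$ and $\beta_{\rho_x}(u,v)=\rho_x(v)-\rho_x(u)-\langle\nabla\rho_x(u),v-u\rangle$. Algorithm 1 (inner solver for approximately minimizing $\tilde\Omega_{x,M}$). Input: $x\in\mathrm{dom}\,\psi$, $\nabla\tilde f(x)\in\partial\tilde f(x)$, $M,\epsilon>0$. Step 0: set $L_{x,M}=\mathrm{trace}(\nabla^2f(x))+\frac{3M}2\left[\frac{96\|\nabla\tilde f(x)\|}{M}\right]^{2/3}$, $\beta_{x,M}=\frac12\mathrm{trace}(\nabla^2f(x))\left[\frac{96\|\nabla\tilde f(x)\|}{M}\right]^{2/3}+\frac M8\left[\frac{96\|\nabla\tilde f(x)\|}{M}\right]^{4/3}$, $y_0=x$, $\alpha=0$, $k=0$. Step 1: compute $y_{k+1}=\arg\min_{y\in\mathbb{R}^n}\{\langle\nabla\Omega_{x,M}(y_k),y-y_k\rangle+3\beta_{\rho_x}(y_k,y)+\psi(y)\}$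 and $g_\psi(y_{k+1})=-\nabla\Omega_{x,M}(y_k)+3[\nabla\rho_x(y_k)-\nabla\rho_x(y_{k+1})]$. Step 2: if $\|\nabla\Omega_{x,M}(y_{k+1})+g_\psi(y_{k+1})\|\le\epsilon/7$ or $\|\nabla\Omega_{x,M}(y_{k+1})+g_\psi(y_{k+1})\|\le\frac M6\|y_{k+1}-x\|^3$, set $x^+=y_{k+1}$ and stop. Step 3: if $\|\nabla\Omega_{x,M}(y_{k+1})+g_\psi(y_{k+1})\|^4>\frac{3^8L_{x,M}^4\beta_{x,M}}{2M(6/5)^k}$, set $x^+=y_{k+1}$, $\alpha=1$ and stop. Step 4: set $k:=k+1$ and go to Step 1. Output: $(x^+,\alpha)$, together with $g_\psi(x^+)$. Algorithm 2. Step 0: choose $x_0\in\mathrm{dom}\,\psi$, $M_0,\epsilon>0$; set $t=0$. Step 1: let $i$ be the smallest integer $\ge0$ with $2^iM_t\ge2M_0$. Step 1.1: apply Algorithm 1 with $x=x_t$, $M=2^iM_t$ and the same $\epsilon$; let $(x^+_{t,i},\alpha_{t,i})$ be its output and $\nabla\tilde f(x^+_{t,i})=\nabla f(x^+_{t,i})+g_\psi(x^+_{t,i})$. Step 1.2: if $\alpha_{t,i}=1$, set $i:=i+1$ and go to Step 1.1. Step 1.3: if $\|\nabla\tilde f(x^+_{t,i})\|\le\epsilon$, set $x_{t+1}=x^+_{t,i}$ and stop. Step 1.4: if $\tilde f(x_t)-\tilde f(x^+_{t,i})\ge\frac1{6(2^iM_t)^{1/3}}\|\nabla\tilde f(x^+_{t,i})\|^{4/3}$,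 set $i_t=i$ and go to Step 2; otherwise set $i:=i+1$ and go to Step 1.1. Step 2: set $x_{t+1}=x^+_{t,i_t}$, $M_{t+1}=2^{i_t-1}M_t$, $t:=t+1$, and go to Step 1. *)

theory Defs
  imports "HOL-Analysis.Analysis" "HOL-Library.Landau_Symbols"
begin

text \<open>The Frechet derivative as a bounded linear map. Iterating it gives the multilinear
  derivatives as elements of nested spaces of bounded linear maps, whose norm is the induced
  (operator) norm. It is meaningful only where \<open>f\<close> is differentiable.\<close>

definition Deriv_bl ::
  "('a::real_normed_vector \<Rightarrow> 'b::real_normed_vector) \<Rightarrow> 'a \<Rightarrow> 'a \<Rightarrow>\<^sub>L 'b" where
  "Deriv_bl f x = Blinfun (frechet_derivative f (at x))"

abbreviation D1 :: "(real^'n \<Rightarrow> real) \<Rightarrow> real^'n \<Rightarrow> (real^'n) \<Rightarrow>\<^sub>L real" where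
  "D1 f \<equiv> Deriv_bl f"

abbreviation D2 :: "(real^'n \<Rightarrow> real) \<Rightarrow> real^'n \<Rightarrow> (real^'n) \<Rightarrow>\<^sub>L (real^'n) \<Rightarrow>\<^sub>L real" where
  "D2 f \<equiv> Deriv_bl (Deriv_bl f)"

abbreviation D3 ::
  "(real^'n \<Rightarrow> real) \<Rightarrow> real^'n \<Rightarrow> (real^'n) \<Rightarrow>\<^sub>L (real^'n) \<Rightarrow>\<^sub>L (real^'n) \<Rightarrow>\<^sub>L real" where
  "D3 f \<equiv> Deriv_bl (Deriv_bl (Deriv_bl f))"

definition three_times_differentiable :: "(real^'n \<Rightarrow> real) \<Rightarrow> bool" where
  "three_times_differentiable f \<longleftrightarrow>
     (\<forall>x. f differentiable (at x) \<and> D1 f differentiable (at x) \<and> D2 f differentiable (at x))"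

definition gradient :: "(real^'n \<Rightarrow> real) \<Rightarrow> real^'n \<Rightarrow> real^'n" where
  "gradient f x = (THE g. GDERIV f x :> g)"

definition hessian :: "(real^'n \<Rightarrow> real) \<Rightarrow> real^'n \<Rightarrow> real^'n^'n" where
  "hessian f x = (\<chi> i j. blinfun_apply (blinfun_apply (D2 f x) (axis i 1)) (axis j 1))"

definition eff_dom :: "('a \<Rightarrow> ereal) \<Rightarrow> 'a set" where
  "eff_dom \<psi> = {x. \<psi> x < \<infinity>}"

definition econvex :: "(real^'n \<Rightarrow> ereal) \<Rightarrow> bool" where
  "econvex \<psi> \<longleftrightarrow> (\<forall>x. \<psi> x \<noteq> -\<infinity>) \<and>
     (\<forall>x y. \<forall>u::real. 0 < u \<and> u < 1 \<longrightarrow>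
        \<psi> (u *\<^sub>R x + (1 - u) *\<^sub>R y) \<le> ereal u * \<psi> x + ereal (1 - u) * \<psi> y)"

definition subdifferential :: "(real^'n \<Rightarrow> ereal) \<Rightarrow> real^'n \<Rightarrow> (real^'n) set" where
  "subdifferential h x =
     {g. x \<in> eff_dom h \<and> (\<forall>y. h x + ereal (g \<bullet> (y - x)) \<le> h y)}"

definition ftilde :: "(real^'n \<Rightarrow> real) \<Rightarrow> (real^'n \<Rightarrow> ereal) \<Rightarrow> real^'n \<Rightarrow> ereal" where
  "ftilde f \<psi> x = ereal (f x) + \<psi> x"

definition Phi :: "(real^'n \<Rightarrow> real) \<Rightarrow> real^'n \<Rightarrow> real^'n \<Rightarrow> real" where
  "Phi f x y = (let h = y - x in
     f x + blinfun_apply (D1 f x) h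
       + 1 / 2 * blinfun_apply (blinfun_apply (D2 f x) h) h
       + 1 / 6 * blinfun_apply (blinfun_apply (blinfun_apply (D3 f x) h) h) h)"

definition Omega :: "(real^'n \<Rightarrow> real) \<Rightarrow> real \<Rightarrow> real^'n \<Rightarrow> real^'n \<Rightarrow> real" where
  "Omega f M x y = Phi f x y + M / 8 * norm (y - x) ^ 4"

definition rho :: "(real^'n \<Rightarrow> real) \<Rightarrow> real \<Rightarrow> real^'n \<Rightarrow> real^'n \<Rightarrow> real" where
  "rho f M x y = 1 / 2 * ((hessian f x *v (y - x)) \<bullet> (y - x)) + M / 8 * norm (y - x) ^ 4"

definition bregman :: "(real^'n \<Rightarrow> real) \<Rightarrow> real^'n \<Rightarrow> real^'n \<Rightarrow> real" where
  "bregman h u v = h v - h u - gradient h u \<bullet> (v - u)"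

definition inner_obj ::
  "(real^'n \<Rightarrow> real) \<Rightarrow> (real^'n \<Rightarrow> ereal) \<Rightarrow> real \<Rightarrow> real^'n \<Rightarrow> real^'n \<Rightarrow> real^'n \<Rightarrow> ereal" where
  "inner_obj f \<psi> M x y z =
     ereal (gradient (Omega f M x) y \<bullet> (z - y) + 3 * bregman (rho f M x) y z) + \<psi> z"

text \<open>A function \<open>\<psi>\<close> is simple (for \<open>f\<close>) if the auxiliary problems of the inner method can be
  solved, i.e. the argmin defining its iterates exists. This is automatic
  for proper convex lower semicontinuous \<open>\<psi>\<close>; the minimizer is unique because \<open>rho f M x\<close> is strictly convex.\<close>

definition simple_for :: "(real^'n \<Rightarrow> real) \<Rightarrow> (real^'n \<Rightarrow> ereal) \<Rightarrow> bool" where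
  "simple_for f \<psi> \<longleftrightarrow>
     (\<forall>x\<in>eff_dom \<psi>. \<forall>y\<in>eff_dom \<psi>. \<forall>M>0. \<exists>z. is_arg_min (inner_obj f \<psi> M x y) (\<lambda>_. True) z)"

primrec inner_iter ::
  "(real^'n \<Rightarrow> real) \<Rightarrow> (real^'n \<Rightarrow> ereal) \<Rightarrow> real \<Rightarrow> real^'n \<Rightarrow> nat \<Rightarrow> real^'n" where
  "inner_iter f \<psi> M x 0 = x"
| "inner_iter f \<psi> M x (Suc k) = arg_min (inner_obj f \<psi> M x (inner_iter f \<psi> M x k)) (\<lambda>_. True)"

text \<open>The subgradient \<open>g\<^sub>\<psi>(y\<^sub>k\<^sub>+\<^sub>1)\<close> of \<open>\<psi>\<close>, indexed by \<open>k\<close>.\<close>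

definition inner_gpsi ::
  "(real^'n \<Rightarrow> real) \<Rightarrow> (real^'n \<Rightarrow> ereal) \<Rightarrow> real \<Rightarrow> real^'n \<Rightarrow> nat \<Rightarrow> real^'n" where
  "inner_gpsi f \<psi> M x k =
     (let y = inner_iter f \<psi> M x k; y' = inner_iter f \<psi> M x (Suc k) in
        - gradient (Omega f M x) y
        + 3 *\<^sub>R (gradient (rho f M x) y - gradient (rho f M x) y'))"

definition inner_residual ::
  "(real^'n \<Rightarrow> real) \<Rightarrow> (real^'n \<Rightarrow> ereal) \<Rightarrow> real \<Rightarrow> real^'n \<Rightarrow> nat \<Rightarrow> real" where
  "inner_residual f \<psi> M x k =
     norm (gradient (Omega f M x) (inner_iter f \<psi> M x (Suc k)) + inner_gpsi f \<psi> M x k)"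

text \<open>Below, \<open>g\<close> is the chosen element of the subdifferential of \<open>f + \<psi>\<close> at \<open>x\<close>.\<close>

definition L_const :: "(real^'n \<Rightarrow> real) \<Rightarrow> real \<Rightarrow> real^'n \<Rightarrow> real^'n \<Rightarrow> real" where
  "L_const f M x g =
     trace (hessian f x) + 3 * M / 2 * (96 * norm g / M) powr (2 / 3)"

definition beta_const :: "(real^'n \<Rightarrow> real) \<Rightarrow> real \<Rightarrow> real^'n \<Rightarrow> real^'n \<Rightarrow> real" where
  "beta_const f M x g =
     1 / 2 * trace (hessian f x) * (96 * norm g / M) powr (2 / 3)
     + M / 8 * (96 * norm g / M) powr (4 / 3)"

definition inner_success ::
  "(real^'n \<Rightarrow> real) \<Rightarrow> (real^'n \<Rightarrow> ereal) \<Rightarrow> real \<Rightarrow> real \<Rightarrow> real^'n \<Rightarrow> nat \<Rightarrow> bool" where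
  "inner_success f \<psi> \<epsilon> M x k \<longleftrightarrow>
     inner_residual f \<psi> M x k \<le> \<epsilon> / 7 \<or>
     inner_residual f \<psi> M x k \<le> M / 6 * norm (inner_iter f \<psi> M x (Suc k) - x) ^ 3"

definition inner_failure ::
  "(real^'n \<Rightarrow> real) \<Rightarrow> (real^'n \<Rightarrow> ereal) \<Rightarrow> real \<Rightarrow> real^'n \<Rightarrow> real^'n \<Rightarrow> nat \<Rightarrow> bool" where
  "inner_failure f \<psi> M x g k \<longleftrightarrow>
     inner_residual f \<psi> M x k ^ 4 >
       3 ^ 8 * L_const f M x g ^ 4 * beta_const f M x g / (2 * M * (6 / 5) ^ k)"

text \<open>\<open>alg1 f \<psi> \<epsilon> x g M xp \<alpha> gp N\<close>: started at \<open>x\<close> with subgradient \<open>g\<close> and parameters \<open>M, \<epsilon>\<close>,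
  the inner method stops after exactly \<open>N\<close> iterations, i.e. computed argmins, and outputs
  the point \<open>xp\<close>, the flag \<open>\<alpha>\<close> and the subgradient \<open>gp\<close> of \<open>\<psi>\<close> at \<open>xp\<close>.\<close>

definition alg1 ::
  "(real^'n \<Rightarrow> real) \<Rightarrow> (real^'n \<Rightarrow> ereal) \<Rightarrow> real \<Rightarrow> real^'n \<Rightarrow> real^'n \<Rightarrow> real
     \<Rightarrow> real^'n \<Rightarrow> nat \<Rightarrow> real^'n \<Rightarrow> nat \<Rightarrow> bool" where
  "alg1 f \<psi> \<epsilon> x g M xp \<alpha> gp N \<longleftrightarrow>
     (\<exists>k. N = Suc k \<and>
        (\<forall>j<k. \<not> inner_success f \<psi> \<epsilon> M x j \<and> \<not> inner_failure f \<psi> M x g j) \<and>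
        (inner_success f \<psi> \<epsilon> M x k \<and> \<alpha> = 0 \<or>
         \<not> inner_success f \<psi> \<epsilon> M x k \<and> inner_failure f \<psi> M x g k \<and> \<alpha> = 1) \<and>
        xp = inner_iter f \<psi> M x (Suc k) \<and> gp = inner_gpsi f \<psi> M x k)"

definition first_i :: "real \<Rightarrow> real \<Rightarrow> nat" where
  "first_i M0 M = (LEAST i. 2 ^ i * M \<ge> 2 * M0)"

definition sufficient_decrease ::
  "(real^'n \<Rightarrow> real) \<Rightarrow> (real^'n \<Rightarrow> ereal) \<Rightarrow> real \<Rightarrow> real^'n \<Rightarrow> real^'n \<Rightarrow> real^'n \<Rightarrow> bool" where
  "sufficient_decrease f \<psi> M x xp gp \<longleftrightarrow>
     ftilde f \<psi> x - ftilde f \<psi> xp \<ge>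
       ereal (1 / (6 * M powr (1 / 3)) * norm (gradient f xp + gp) powr (4 / 3))"

text \<open>\<open>alg2_state f \<psi> M0 \<epsilon> x0 g0 t x g M i N\<close>: the outer method is about to call the inner method
  with parameter \<open>2\<^sup>iM\<close> in outer iteration \<open>t\<close>, where \<open>x\<^sub>t = x\<close>, \<open>M\<^sub>t = M\<close> and \<open>g\<close> is the chosen
  subgradient of \<open>f + \<psi>\<close> at \<open>x\<^sub>t\<close>, after \<open>N\<close> inner iterations in total (over all calls of the inner method, including those whose result was rejected).\<close>

inductive alg2_state ::
  "(real^'n \<Rightarrow> real) \<Rightarrow> (real^'n \<Rightarrow> ereal) \<Rightarrow> real \<Rightarrow> real \<Rightarrow> real^'n \<Rightarrow> real^'n
     \<Rightarrow> nat \<Rightarrow> real^'n \<Rightarrow> real^'n \<Rightarrow> real \<Rightarrow> nat \<Rightarrow> nat \<Rightarrow> bool"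
  for f \<psi> M0 \<epsilon> x0 g0 where
  init: "alg2_state f \<psi> M0 \<epsilon> x0 g0 0 x0 g0 M0 (first_i M0 M0) 0"
| flagged: "\<lbrakk>alg2_state f \<psi> M0 \<epsilon> x0 g0 t x g M i N;
     alg1 f \<psi> \<epsilon> x g (2 ^ i * M) xp 1 gp k\<rbrakk>
   \<Longrightarrow> alg2_state f \<psi> M0 \<epsilon> x0 g0 t x g M (Suc i) (N + k)"
| no_decrease: "\<lbrakk>alg2_state f \<psi> M0 \<epsilon> x0 g0 t x g M i N;
     alg1 f \<psi> \<epsilon> x g (2 ^ i * M) xp 0 gp k;
     norm (gradient f xp + gp) > \<epsilon>;
     \<not> sufficient_decrease f \<psi> (2 ^ i * M) x xp gp\<rbrakk>
   \<Longrightarrow> alg2_state f \<psi> M0 \<epsilon> x0 g0 t x g M (Suc i) (N + k)"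
| accept: "\<lbrakk>alg2_state f \<psi> M0 \<epsilon> x0 g0 t x g M i N;
     alg1 f \<psi> \<epsilon> x g (2 ^ i * M) xp 0 gp k;
     norm (gradient f xp + gp) > \<epsilon>;
     sufficient_decrease f \<psi> (2 ^ i * M) x xp gp;
     M' = 2 ^ i * M / 2\<rbrakk>
   \<Longrightarrow> alg2_state f \<psi> M0 \<epsilon> x0 g0 (Suc t) xp (gradient f xp + gp) M' (first_i M0 M') (N + k)"

text \<open>\<open>alg2_generates f \<psi> M0 \<epsilon> x0 g0 xb gb N\<close>: after \<open>N\<close> inner iterations in total, the outer method sets
  \<open>x\<^sub>t\<^sub>+\<^sub>1 = xb\<close> for some \<open>t\<close>, either stopping there or continuing from there, and \<open>gb\<close> is the
  associated subgradient of \<open>f + \<psi>\<close> at \<open>xb\<close>.\<close>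

inductive alg2_generates ::
  "(real^'n \<Rightarrow> real) \<Rightarrow> (real^'n \<Rightarrow> ereal) \<Rightarrow> real \<Rightarrow> real \<Rightarrow> real^'n \<Rightarrow> real^'n
     \<Rightarrow> real^'n \<Rightarrow> real^'n \<Rightarrow> nat \<Rightarrow> bool"
  for f \<psi> M0 \<epsilon> x0 g0 where
  stop: "\<lbrakk>alg2_state f \<psi> M0 \<epsilon> x0 g0 t x g M i N;
     alg1 f \<psi> \<epsilon> x g (2 ^ i * M) xp 0 gp k;
     norm (gradient f xp + gp) \<le> \<epsilon>\<rbrakk>
   \<Longrightarrow> alg2_generates f \<psi> M0 \<epsilon> x0 g0 xp (gradient f xp + gp) (N + k)"
| accept: "\<lbrakk>alg2_state f \<psi> M0 \<epsilon> x0 g0 t x g M i N;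
     alg1 f \<psi> \<epsilon> x g (2 ^ i * M) xp 0 gp k;
     norm (gradient f xp + gp) > \<epsilon>;
     sufficient_decrease f \<psi> (2 ^ i * M) x xp gp\<rbrakk>
   \<Longrightarrow> alg2_generates f \<psi> M0 \<epsilon> x0 g0 xp (gradient f xp + gp) (N + k)"

end

(*
Write H and T for the second and third derivative of f at x. Taylor's formula for the Hessian, which
is positive semidefinite everywhere, gives |T[w,d,d]| <= H[d,d]/c + (c L/2) |w|^2 |d|^2 for all c > 0.
The Bregman distance of a cubic is exact, namely T[u + d/3, d, d]/2 for a step d from u, so for M >= 4 L
the Bregman distance of the regularized model lies between 1/2 and 3 times that of its reference
function rho. Hence the inner method contracts the rho-distance to any later iterate by 5/6
per step; applied to two consecutive iterates, this bounds the residual and shows that the failure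
test never fires when M >= 4 L. In that range a successful inner call with a large gradient also gives
the required decrease, so M stays bounded. Whatever M is, an inner call that neither succeeds nor
fails at step k has (eps/7)^4 < C (5/6)^k, so calls have length O(|log eps|).

A rejected call doubles M and an accepted one at most halves it, so the number of calls is at most
2 t + O(1) after t accepted steps. Each accepted step decreases the gap by a multiple of |g|^(4/3),
and |g| R0 dominates both the new gap and eps R0; hence (gap + eps R0)^(-1/3) grows by a constant per
step, which leaves room for O(eps^(-1/3)) steps. A small subgradient settles both assertions.
*)
theory Submission
  imports Defs
begin

section \<open>Differential calculus\<close>

lemma Deriv_bl_has_derivative:
  assumes "F differentiable (at x)"
  shows "(F has_derivative blinfun_apply (Deriv_bl F x)) (at x)"
  using assms unfolding Deriv_bl_def
  by (metis bounded_linear_Blinfun_apply frechet_derivative_works has_derivative_bounded_linear)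

text \<open>The Riesz representer of \<open>F'\<close> is \<open>adjoint F' 1\<close>; by its
  uniqueness the description operator in \<open>gradient\<close> denotes it. Gradients can thus be
  computed through inner products with test vectors.\<close>

lemma gradient_inner:
  fixes F :: "real^'n \<Rightarrow> real"
  assumes "(F has_derivative F') (at y)"
  shows "gradient F y \<bullet> k = F' k"
proof -
  have lin: "linear F'"
    using assms has_derivative_linear by blast
  have eq: "F' = (\<lambda>h. h \<bullet> adjoint F' 1)"
    by (rule ext) (simp add: adjoint_works[OF lin])
  have "GDERIV F y :> adjoint F' 1"
    using assms unfolding gderiv_def by (subst eq[symmetric])
  moreover have "D = adjoint F' 1" if "GDERIV F y :> D" for D
  proof -
    have "F' = (\<lambda>h. h \<bullet> D)"
      using that assms has_derivative_unique unfolding gderiv_def by blast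
    then have "h \<bullet> D = h \<bullet> adjoint F' 1" for h
      by (metis eq)
    then show ?thesis
      using vector_eq_ldot by blast
  qed
  ultimately have "gradient F y = adjoint F' 1"
    unfolding gradient_def by (rule the_equality)
  then show ?thesis
    by (metis eq inner_commute)
qed

text \<open>Integrates a derivative bound by monotonicity of \<open>G\<close> minus its majorant.
  With \<open>n\<close> = 1, 2, 3 it lifts the Lipschitz bound on the third derivative to Taylor
  remainders of \<open>D2 f\<close>, \<open>D1 f\<close> and \<open>f\<close>.\<close>

lemma power_bound_from_derivative:
  fixes G G' :: "real \<Rightarrow> real"
  assumes "\<And>t. 0 \<le> t \<Longrightarrow> t \<le> s \<Longrightarrow> (G has_real_derivative G' t) (at t)"
    and "\<And>t. 0 \<le> t \<Longrightarrow> t \<le> s \<Longrightarrow> \<bar>G' t\<bar> \<le> c * t ^ n"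
    and "0 \<le> s" "G 0 = 0"
  shows "\<bar>G s\<bar> \<le> c / real (Suc n) * s ^ Suc n"
proof -
  have up: "K s \<le> c / real (Suc n) * s ^ Suc n"
    if K: "\<And>t. 0 \<le> t \<Longrightarrow> t \<le> s \<Longrightarrow> (K has_real_derivative K' t) (at t)"
      and K': "\<And>t. 0 \<le> t \<Longrightarrow> t \<le> s \<Longrightarrow> K' t \<le> c * t ^ n" and K0: "K 0 = 0" for K K'
  proof -
    have "K s - c / real (Suc n) * s ^ Suc n \<le> K 0 - c / real (Suc n) * 0 ^ Suc n"
    proof (rule DERIV_nonpos_imp_nonincreasing[OF \<open>0 \<le> s\<close>])
      fix t assume t: "0 \<le> t" "t \<le> s"
      have "((\<lambda>t. K t - c / real (Suc n) * t ^ Suc n) has_real_derivative K' t - c * t ^ n) (at t)"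
        by (rule derivative_eq_intros K[OF t] refl)+ (simp add: field_simps)
      then show "\<exists>y. ((\<lambda>t. K t - c / real (Suc n) * t ^ Suc n) has_real_derivative y) (at t) \<and> y \<le> 0"
        using K'[OF t] by force
    qed
    then show ?thesis using K0 by simp
  qed
  have "G s \<le> c / real (Suc n) * s ^ Suc n"
    using assms by (intro up[of G G']) (auto simp: abs_le_iff)
  moreover have "- G s \<le> c / real (Suc n) * s ^ Suc n"
    using assms by (intro up[of "\<lambda>t. - G t" "\<lambda>t. - G' t"]) (auto simp: abs_le_iff intro!: DERIV_minus)
  ultimately show ?thesis by simp
qed

text \<open>The second difference of \<open>F\<close> along \<open>u\<close> and \<open>v\<close> is symmetric in \<open>u, v\<close>, and by the
  mean value theorem it is approximated by \<open>F'' u v\<close>.\<close>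

lemma second_difference_approx:
  fixes F :: "'a::real_normed_vector \<Rightarrow> real"
  assumes F: "\<And>y. (F has_derivative blinfun_apply (F' y)) (at y)"
    and F': "(F' has_derivative blinfun_apply F'') (at x)"
    and e: "0 < e"
  shows "\<forall>\<^sub>F t in at_right 0.
    \<bar>F (x + t *\<^sub>R u + t *\<^sub>R v) - F (x + t *\<^sub>R u) - F (x + t *\<^sub>R v) + F x - t\<^sup>2 * F'' u v\<bar>
      \<le> e * (2 * (norm u + norm v) * norm v) * t\<^sup>2"
proof -
  obtain \<delta> where \<delta>: "0 < \<delta>"
    and approx: "\<And>y. norm (y - x) < \<delta> \<Longrightarrow> norm (F' y - F' x - F'' (y - x)) \<le> e * norm (y - x)"
    using F' e unfolding has_derivative_at_alt by blast
  define r where "r = norm u + norm v"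
  have r: "0 \<le> r" unfolding r_def by simp
  have "\<forall>\<^sub>F t in at_right 0. t < \<delta> / (r + 1)"
    using \<delta> r by (intro eventually_at_rightI[of _ "\<delta> / (r + 1)"]) auto
  moreover have "\<forall>\<^sub>F t in at_right 0. (0::real) < t"
    by (simp add: eventually_at_right_less)
  ultimately show ?thesis
  proof eventually_elim
    case (elim t)
    then have t: "0 < t" "t * (r + 1) < \<delta>"
      using r by (auto simp: field_simps)
    define g where "g s = F (x + t *\<^sub>R u + (s * t) *\<^sub>R v) - F (x + (s * t) *\<^sub>R v)" for s
    define g' where "g' s = t * (F' (x + t *\<^sub>R u + (s * t) *\<^sub>R v) v - F' (x + (s * t) *\<^sub>R v) v)" for s
    have "(g has_real_derivative g' s) (at s)" for s
      unfolding g_def[abs_def] g'_def has_field_derivative_def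
      by (rule derivative_eq_intros has_derivative_compose[OF _ F] refl)+
        (auto simp: fun_eq_iff blinfun.bilinear_simps algebra_simps)
    then obtain \<xi> where \<xi>: "0 < \<xi>" "\<xi> < 1" "g 1 - g 0 = g' \<xi>"
      using MVT2[of 0 1 g g'] by auto
    define y z where "y = x + t *\<^sub>R u + (\<xi> * t) *\<^sub>R v" and "z = x + (\<xi> * t) *\<^sub>R v"
    have yz: "norm (y - x) \<le> t * r" "norm (z - x) \<le> t * r"
    proof -
      have "norm (y - x) \<le> t * norm u + \<xi> * t * norm v"
        using t \<xi> norm_triangle_ineq[of "t *\<^sub>R u" "(\<xi> * t) *\<^sub>R v"] by (simp add: y_def)
      moreover have "\<xi> * (t * norm v) \<le> 1 * (t * norm v)"
        using t \<xi> by (intro mult_right_mono) auto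
      ultimately show "norm (y - x) \<le> t * r"
        by (simp add: r_def algebra_simps)
      have "norm (z - x) = \<xi> * (t * norm v)" "0 \<le> t * norm u"
        using t \<xi> by (simp_all add: z_def)
      with \<open>\<xi> * (t * norm v) \<le> 1 * (t * norm v)\<close> show "norm (z - x) \<le> t * r"
        unfolding r_def distrib_left by linarith
    qed
    have small: "t * r < \<delta>" using t r by (simp add: algebra_simps)
    have "norm (F' y - F' x - F'' (y - x)) \<le> e * (t * r)"
      "norm (F' z - F' x - F'' (z - x)) \<le> e * (t * r)"
      using approx[of y] approx[of z] yz small e
      by (auto intro: order_trans mult_left_mono)
    \<comment> \<open>Subtracting the two linearizations cancels \<open>F' x\<close> and leaves
      \<open>F''\<close> at \<open>y - z\<close>, which is \<open>t\<close> times
      \<open>u\<close>.\<close>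
    then have "norm ((F' y - F' x - F'' (y - x)) - (F' z - F' x - F'' (z - x))) \<le> 2 * (e * (t * r))"
      by (smt (verit) norm_triangle_ineq4)
    moreover have "(F' y - F' x - F'' (y - x)) - (F' z - F' x - F'' (z - x)) = F' y - F' z - t *\<^sub>R F'' u"
      by (simp add: y_def z_def blinfun.bilinear_simps algebra_simps)
    ultimately have nb: "norm (F' y - F' z - t *\<^sub>R F'' u) \<le> 2 * (e * (t * r))" by simp
    have "\<bar>(F' y - F' z - t *\<^sub>R F'' u) v\<bar> \<le> norm (F' y - F' z - t *\<^sub>R F'' u) * norm v"
      using norm_blinfun[of "F' y - F' z - t *\<^sub>R F'' u" v] by simp
    also have "\<dots> \<le> 2 * (e * (t * r)) * norm v"
      by (rule mult_right_mono[OF nb norm_ge_zero])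
    finally have "\<bar>(F' y - F' z - t *\<^sub>R F'' u) v\<bar> \<le> 2 * (e * (t * r)) * norm v" .
    moreover have "g' \<xi> - t\<^sup>2 * F'' u v = t * ((F' y - F' z - t *\<^sub>R F'' u) v)"
      by (simp add: g'_def y_def z_def blinfun.bilinear_simps power2_eq_square algebra_simps)
    ultimately have "\<bar>g' \<xi> - t\<^sup>2 * F'' u v\<bar> \<le> t * (2 * (e * (t * r)) * norm v)"
      using t by (simp add: abs_mult)
    moreover have "F (x + t *\<^sub>R u + t *\<^sub>R v) - F (x + t *\<^sub>R u) - F (x + t *\<^sub>R v) + F x = g' \<xi>"
      using \<xi>(3) by (simp add: g_def)
    ultimately show ?case
      by (simp add: r_def power2_eq_square algebra_simps)
  qed
qed

text \<open>One and the same second difference approximates both t^2 F''(u,v) and t^2 F''(v,u);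
  after division by t^2 the two values differ by an arbitrarily small amount.\<close>

lemma second_derivative_symmetric:
  fixes F :: "'a::real_normed_vector \<Rightarrow> real"
  assumes F: "\<And>y. (F has_derivative blinfun_apply (F' y)) (at y)"
    and F': "(F' has_derivative blinfun_apply F'') (at x)"
  shows "F'' u v = F'' v u"
proof -
  define C where "C = 2 * (norm u + norm v) * norm v + 2 * (norm v + norm u) * norm u"
  have C: "0 \<le> C" unfolding C_def by simp
  have "\<bar>F'' u v - F'' v u\<bar> \<le> 0 + e" if "0 < e" for e
  proof -
    \<comment> \<open>The \<open>+ 1\<close> guards against \<open>C = 0\<close>.\<close>
    define d where "d = e / (C + 1)"
    have d: "0 < d" "d * C \<le> e" using that C by (auto simp: d_def field_simps)
    have "\<forall>\<^sub>F t in at_right (0::real). 0 < t"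
      by (simp add: eventually_at_right_less)
    with second_difference_approx[OF F F' d(1), of u v] second_difference_approx[OF F F' d(1), of v u]
    have "\<forall>\<^sub>F t in at_right (0::real). \<bar>F'' u v - F'' v u\<bar> \<le> d * C"
    proof eventually_elim
      case (elim t)
      have comm: "x + t *\<^sub>R v + t *\<^sub>R u = x + t *\<^sub>R u + t *\<^sub>R v" by simp
      have "\<bar>t\<^sup>2 * F'' u v - t\<^sup>2 * F'' v u\<bar> \<le> d * C * t\<^sup>2"
        using elim(1,2) unfolding comm C_def by (simp add: algebra_simps abs_le_iff)
      then have "t\<^sup>2 * \<bar>F'' u v - F'' v u\<bar> \<le> t\<^sup>2 * (d * C)"
        by (simp add: abs_mult flip: right_diff_distrib) (simp add: mult_ac)
      then show ?case
        using elim(3) by simp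
    qed
    then obtain t where "\<bar>F'' u v - F'' v u\<bar> \<le> d * C"
      using eventually_happens[of _ "at_right (0::real)"] by fastforce
    with d show ?thesis by simp
  qed
  then have "\<bar>F'' u v - F'' v u\<bar> \<le> 0"
    by (rule field_le_epsilon)
  then show ?thesis by simp
qed

lemma has_derivative_line:
  fixes F :: "'a::real_normed_vector \<Rightarrow> real"
  assumes "(F has_derivative F') (at (x + t *\<^sub>R h))"
  shows "((\<lambda>s. F (x + s *\<^sub>R h)) has_real_derivative F' h) (at t)"
proof -
  have "((\<lambda>s. x + s *\<^sub>R h) has_derivative (\<lambda>s. s *\<^sub>R h)) (at t)"
    by (auto intro!: derivative_eq_intros)
  then have "((\<lambda>s. F (x + s *\<^sub>R h)) has_derivative (\<lambda>s. F' (s *\<^sub>R h))) (at t)"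
    by (rule has_derivative_compose) (rule assms)
  moreover have "(\<lambda>s. F' (s *\<^sub>R h)) = (*) (F' h)"
    using linear_scale[OF has_derivative_linear[OF assms]] by (auto simp: fun_eq_iff)
  ultimately show ?thesis
    unfolding has_field_derivative_def by simp
qed

text \<open>The right limit of difference quotients keeps the bound. This turns inequalities along
  segments into the tangent inequality, positivity of the Hessian and the optimality condition of
  the inner problem.\<close>

lemma directional_derivative_le:
  fixes F :: "'a::real_normed_vector \<Rightarrow> real"
  assumes F: "(F has_derivative F') (at z)"
    and le: "\<And>t. 0 < t \<Longrightarrow> t < 1 \<Longrightarrow> F (z + t *\<^sub>R d) - F z \<le> t * c"
  shows "F' d \<le> c"
proof -
  have "((\<lambda>s. F (z + s *\<^sub>R d)) has_real_derivative F' d) (at 0)"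
    by (rule has_derivative_line) (simp add: F)
  then have "((\<lambda>t. (F (z + t *\<^sub>R d) - F z) / t) \<longlongrightarrow> F' d) (at 0)"
    by (simp add: DERIV_def)
  then have "((\<lambda>t. (F (z + t *\<^sub>R d) - F z) / t) \<longlongrightarrow> F' d) (at_right 0)"
    by (rule filterlim_mono) (simp_all add: at_within_le_at)
  moreover have "\<forall>\<^sub>F t in at_right 0. (F (z + t *\<^sub>R d) - F z) / t \<le> c"
    using le by (intro eventually_at_rightI[of _ 1]) (auto simp: field_simps)
  ultimately show ?thesis
    by (rule tendsto_upperbound) simp
qed

lemma convex_on_above_tangent:
  fixes F :: "'a::real_normed_vector \<Rightarrow> real"
  assumes "convex_on UNIV F" and "(F has_derivative F') (at x)"
  shows "F x + F' (y - x) \<le> F y"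
proof -
  have "F' (y - x) \<le> F y - F x"
  proof (rule directional_derivative_le[OF assms(2)])
    fix t :: real assume t: "0 < t" "t < 1"
    have "F ((1 - t) *\<^sub>R x + t *\<^sub>R y) \<le> (1 - t) * F x + t * F y"
      using t by (intro convex_onD[OF assms(1)]) auto
    moreover have "(1 - t) *\<^sub>R x + t *\<^sub>R y = x + t *\<^sub>R (y - x)"
      by (simp add: algebra_simps)
    ultimately show "F (x + t *\<^sub>R (y - x)) - F x \<le> t * (F y - F x)"
      by (simp add: algebra_simps)
  qed
  then show ?thesis by simp
qed

text \<open>Polarization on unit vectors: \<open>4 * S a b\<close> is the difference of the
  quadratic form at \<open>a + b\<close> and \<open>a - b\<close>, whose squared norms add up to 4
  by the parallelogram law.\<close>

lemma bilinear_bound_from_quadratic: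
  fixes S :: "'a::real_inner \<Rightarrow> 'a \<Rightarrow> real"
  assumes S: "bilinear S" and sym: "\<And>u v. S u v = S v u"
    and bound: "\<And>e. \<bar>S e e\<bar> \<le> c * (e \<bullet> e)"
  shows "\<bar>S d k\<bar> \<le> c * norm d * norm k"
proof (cases "d = 0 \<or> k = 0")
  case True
  then show ?thesis
    using S by (auto simp: bilinear_lzero bilinear_rzero)
next
  case False
  then have nz: "norm d > 0" "norm k > 0" by auto
  define a b where "a = d /\<^sub>R norm d" and "b = k /\<^sub>R norm k"
  have ab: "a \<bullet> a = 1" "b \<bullet> b = 1"
    using nz by (auto simp: a_def b_def dot_square_norm power2_eq_square)
  have "4 * S a b = S (a + b) (a + b) - S (a - b) (a - b)"
    using S sym[of a b] by (simp add: bilinear_ladd bilinear_radd bilinear_lsub bilinear_rsub)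
  also have "\<bar>\<dots>\<bar> \<le> c * ((a + b) \<bullet> (a + b)) + c * ((a - b) \<bullet> (a - b))"
    using bound[of "a + b"] bound[of "a - b"] by linarith
  also have "\<dots> = 4 * c"
    using ab by (simp add: algebra_simps inner_commute)
  finally have "\<bar>S a b\<bar> \<le> c" by simp
  moreover have "S d k = norm d * norm k * S a b"
  proof -
    have "S d k = S (norm d *\<^sub>R a) (norm k *\<^sub>R b)"
      using nz by (simp add: a_def b_def)
    then show ?thesis
      using S by (simp add: bilinear_lmul bilinear_rmul)
  qed
  ultimately show ?thesis
    using nz by (simp add: abs_mult mult_ac mult_left_mono)
qed

section \<open>Taylor bounds for a convex function with Lipschitz third derivative\<close>

locale lipschitz_third_derivative =
  fixes f :: "real^'n \<Rightarrow> real" and L :: real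
  assumes f_convex: "convex_on UNIV f"
    and f_diff: "three_times_differentiable f"
    and f_lip: "\<And>x y. norm (D3 f x - D3 f y) \<le> L * norm (x - y)"
begin

lemma L_nonneg: "0 \<le> L"
proof -
  \<comment> \<open>The vectors 1 and 0 are distinct, so the factor \<open>norm (1 - 0)\<close> is
    positive.\<close>
  have "0 \<le> L * norm (1 - 0 :: real^'n)"
    by (rule order_trans[OF norm_ge_zero f_lip])
  then show ?thesis
    by (simp add: zero_le_mult_iff)
qed

lemma D1_deriv: "(f has_derivative blinfun_apply (D1 f x)) (at x)"
  and D2_deriv: "(D1 f has_derivative blinfun_apply (D2 f x)) (at x)"
  and D3_deriv: "(D2 f has_derivative blinfun_apply (D3 f x)) (at x)"
proof -
  have d: "f differentiable (at x)" "D1 f differentiable (at x)" "D2 f differentiable (at x)"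
    using f_diff unfolding three_times_differentiable_def by iprover+
  show "(f has_derivative blinfun_apply (D1 f x)) (at x)"
    and "(D1 f has_derivative blinfun_apply (D2 f x)) (at x)"
    and "(D2 f has_derivative blinfun_apply (D3 f x)) (at x)"
    using d[THEN Deriv_bl_has_derivative] by -
qed

lemma gradient_f_inner: "gradient f x \<bullet> k = D1 f x k"
  by (rule gradient_inner[OF D1_deriv])

lemma f_above_tangent: "f x + gradient f x \<bullet> (y - x) \<le> f y"
  using convex_on_above_tangent[OF f_convex D1_deriv] by (simp add: gradient_f_inner)

lemma D2_sym: "D2 f x u v = D2 f x v u"
  by (rule second_derivative_symmetric[OF D1_deriv D2_deriv])

lemma D1_apply_deriv: "((\<lambda>y. D1 f y v) has_derivative (\<lambda>h. D2 f x h v)) (at x)"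
  by (rule derivative_eq_intros D2_deriv refl)+ (simp add: blinfun.bilinear_simps)

lemma D2_apply_deriv: "((\<lambda>y. D2 f y u v) has_derivative (\<lambda>h. D3 f x h u v)) (at x)"
  by (rule derivative_eq_intros D3_deriv refl)+ (simp add: blinfun.bilinear_simps)

lemma D3_sym23: "D3 f x u v w = D3 f x u w v"
proof -
  have "(\<lambda>h. D3 f x h v w) = (\<lambda>h. D3 f x h w v)"
    using D2_apply_deriv[of v w x] D2_apply_deriv[of w v x]
    by (simp add: D2_sym[of _ w v] has_derivative_unique)
  then show ?thesis by meson
qed

text \<open>With the last slot fixed at \<open>w\<close>, the third derivative is the second
  derivative of the scalar function \<open>D1 f y w\<close> of \<open>y\<close>. The functional
  \<open>E\<close> evaluates at \<open>w\<close>, so composing with it yields the derivatives of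
  that function as bounded linear maps.\<close>

lemma D3_sym12: "D3 f x u v w = D3 f x v u w"
proof -
  define E :: "((real^'n) \<Rightarrow>\<^sub>L real) \<Rightarrow>\<^sub>L real" where "E = Blinfun (\<lambda>A. blinfun_apply A w)"
  have E: "blinfun_apply E A = A w" for A
    unfolding E_def by (simp add: bounded_linear_Blinfun_apply blinfun.bounded_linear_left)
  define G where "G = Blinfun (\<lambda>h. E o\<^sub>L D3 f x h)"
  have "bounded_linear (\<lambda>h. E o\<^sub>L D3 f x h)"
    by (intro bounded_linear_intros)
  then have G: "blinfun_apply G h = E o\<^sub>L D3 f x h" for h
    unfolding G_def by (simp add: bounded_linear_Blinfun_apply)
  have "((\<lambda>y. D1 f y w) has_derivative blinfun_apply (E o\<^sub>L D2 f y)) (at y)" for y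
    using D1_apply_deriv[of w y] by (simp add: E blinfun_compose.rep_eq comp_def)
  moreover have "((\<lambda>y. E o\<^sub>L D2 f y) has_derivative blinfun_apply G) (at x)"
    unfolding G by (rule derivative_eq_intros D3_deriv refl)+ (simp add: blinfun.bilinear_simps bounded_bilinear.zero_left[OF bounded_bilinear_blinfun_compose])
  ultimately have "G u v = G v u"
    by (rule second_derivative_symmetric)
  then show ?thesis
    by (simp add: G E)
qed

text \<open>The tangent inequalities at \<open>x\<close> and at \<open>x + t *\<^sub>R d\<close> add
  up to monotonicity of the gradient along \<open>d\<close>; the Hessian form is its
  derivative.\<close>

lemma D2_nonneg: "0 \<le> D2 f x d d"
proof -
  have "((\<lambda>y. - D1 f y d) has_derivative (\<lambda>h. - D2 f x h d)) (at x)"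
    by (intro derivative_intros D1_apply_deriv)
  then have "- D2 f x d d \<le> 0"
  proof (rule directional_derivative_le)
    fix t :: real assume t: "0 < t" "t < 1"
    have "f x + D1 f x (t *\<^sub>R d) \<le> f (x + t *\<^sub>R d)"
      "f (x + t *\<^sub>R d) + D1 f (x + t *\<^sub>R d) (- (t *\<^sub>R d)) \<le> f x"
      using convex_on_above_tangent[OF f_convex D1_deriv, of x "x + t *\<^sub>R d"]
        convex_on_above_tangent[OF f_convex D1_deriv, of "x + t *\<^sub>R d" x] by simp_all
    then have "t * D1 f x d \<le> t * D1 f (x + t *\<^sub>R d) d"
      by (simp add: blinfun.bilinear_simps)
    then show "- D1 f (x + t *\<^sub>R d) d - - D1 f x d \<le> t * 0"
      using t by simp
  qed
  then show ?thesis by simp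
qed

lemma D2_taylor:
  assumes "0 \<le> t"
  shows "\<bar>D2 f (x + t *\<^sub>R h) u v - D2 f x u v - t * D3 f x h u v\<bar>
    \<le> L * (norm h)\<^sup>2 * norm u * norm v / 2 * t\<^sup>2"
proof -
  define G where "G t = D2 f (x + t *\<^sub>R h) u v - D2 f x u v - t * D3 f x h u v" for t
  have "\<bar>G t\<bar> \<le> L * (norm h)\<^sup>2 * norm u * norm v / real (Suc 1) * t ^ Suc 1"
  proof (rule power_bound_from_derivative[where G' = "\<lambda>s. D3 f (x + s *\<^sub>R h) h u v - D3 f x h u v"])
    fix s :: real assume s: "0 \<le> s"
    show "(G has_real_derivative D3 f (x + s *\<^sub>R h) h u v - D3 f x h u v) (at s)"
      unfolding G_def[abs_def]
      by (auto intro!: derivative_eq_intros has_derivative_line[OF D2_apply_deriv])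
    let ?E = "D3 f (x + s *\<^sub>R h) - D3 f x"
    have "\<bar>?E h u v\<bar> \<le> norm (?E h u) * norm v"
      using norm_blinfun[of "?E h u" v] by simp
    also have "\<dots> \<le> norm (?E h) * norm u * norm v"
      by (intro mult_right_mono norm_blinfun norm_ge_zero)
    also have "\<dots> \<le> norm ?E * norm h * norm u * norm v"
      by (intro mult_right_mono norm_blinfun norm_ge_zero)
    also have "\<dots> \<le> (L * norm (x + s *\<^sub>R h - x)) * norm h * norm u * norm v"
      by (intro mult_right_mono f_lip) auto
    finally show "\<bar>D3 f (x + s *\<^sub>R h) h u v - D3 f x h u v\<bar> \<le> L * (norm h)\<^sup>2 * norm u * norm v * s ^ 1"
      using s by (simp add: blinfun.bilinear_simps power2_eq_square mult_ac)
  qed (use assms in \<open>simp_all add: G_def\<close>)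
  then show ?thesis
    by (simp add: G_def power2_eq_square)
qed

lemma D1_taylor:
  assumes "0 \<le> t"
  shows "\<bar>D1 f (x + t *\<^sub>R h) k - D1 f x k - t * D2 f x h k - t\<^sup>2 / 2 * D3 f x h h k\<bar>
    \<le> L * norm h ^ 3 * norm k / 6 * t ^ 3"
proof -
  define G where "G t = D1 f (x + t *\<^sub>R h) k - D1 f x k - t * D2 f x h k - t\<^sup>2 / 2 * D3 f x h h k" for t
  have "\<bar>G t\<bar> \<le> L * norm h ^ 3 * norm k / 2 / real (Suc 2) * t ^ Suc 2"
  proof (rule power_bound_from_derivative
      [where G' = "\<lambda>s. D2 f (x + s *\<^sub>R h) h k - D2 f x h k - s * D3 f x h h k"])
    fix s :: real assume s: "0 \<le> s"
    show "(G has_real_derivative D2 f (x + s *\<^sub>R h) h k - D2 f x h k - s * D3 f x h h k) (at s)"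
      unfolding G_def[abs_def]
      by (auto intro!: derivative_eq_intros has_derivative_line[OF D1_apply_deriv])
    show "\<bar>D2 f (x + s *\<^sub>R h) h k - D2 f x h k - s * D3 f x h h k\<bar>
        \<le> L * norm h ^ 3 * norm k / 2 * s\<^sup>2"
      using D2_taylor[OF s, of x h h k] by (simp add: power2_eq_square power3_eq_cube mult_ac)
  qed (use assms in \<open>simp_all add: G_def\<close>)
  then show ?thesis
    by (simp add: G_def power3_eq_cube)
qed

lemma f_taylor:
  "\<bar>f (x + h) - f x - D1 f x h - 1 / 2 * D2 f x h h - 1 / 6 * D3 f x h h h\<bar> \<le> L / 24 * norm h ^ 4"
proof -
  define G where "G t = f (x + t *\<^sub>R h) - f x - t * D1 f x h - t\<^sup>2 / 2 * D2 f x h h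
    - t ^ 3 / 6 * D3 f x h h h" for t
  have "\<bar>G 1\<bar> \<le> L * norm h ^ 4 / 6 / real (Suc 3) * 1 ^ Suc 3"
  proof (rule power_bound_from_derivative
      [where G' = "\<lambda>s. D1 f (x + s *\<^sub>R h) h - D1 f x h - s * D2 f x h h - s\<^sup>2 / 2 * D3 f x h h h"])
    fix s :: real assume s: "0 \<le> s"
    show "(G has_real_derivative D1 f (x + s *\<^sub>R h) h - D1 f x h - s * D2 f x h h
        - s\<^sup>2 / 2 * D3 f x h h h) (at s)"
      unfolding G_def[abs_def]
      by (auto intro!: derivative_eq_intros has_derivative_line[OF D1_deriv])
    show "\<bar>D1 f (x + s *\<^sub>R h) h - D1 f x h - s * D2 f x h h - s\<^sup>2 / 2 * D3 f x h h h\<bar>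
        \<le> L * norm h ^ 4 / 6 * s ^ 3"
      using D1_taylor[OF s, of x h h] by (simp add: power3_eq_cube power4_eq_xxxx mult_ac)
  qed (simp_all add: G_def)
  then show ?thesis
    by (simp add: G_def)
qed

text \<open>The Hessian at \<open>x + \<tau> *\<^sub>R w\<close> is positive semidefinite, so its
  Taylor expansion bounds \<open>D3 f x w d d\<close> from below; \<open>- w\<close> gives the other
  side. The free \<tau> trades the Hessian form against the Lipschitz term.\<close>

lemma D3_bound:
  assumes "0 < \<tau>"
  shows "\<bar>D3 f x w d d\<bar> \<le> D2 f x d d / \<tau> + \<tau> * L / 2 * (w \<bullet> w) * (d \<bullet> d)"
proof -
  have "- D3 f x w d d \<le> D2 f x d d / \<tau> + \<tau> * L / 2 * (w \<bullet> w) * (d \<bullet> d)" for w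
  proof -
    have "- \<tau> * D3 f x w d d \<le> D2 f x d d + L * (norm w)\<^sup>2 * norm d * norm d / 2 * \<tau>\<^sup>2"
      using D2_taylor[of \<tau> x w d d] D2_nonneg[of "x + \<tau> *\<^sub>R w" d] assms by linarith
    then show ?thesis
      using assms by (simp add: field_simps power2_eq_square dot_square_norm)
  qed
  from this[of w] this[of "- w"] show ?thesis
    by (simp add: blinfun.bilinear_simps abs_le_iff)
qed

end

section \<open>The cubic model and its Bregman distances\<close>

text \<open>The Bregman distance of the fourth power of the norm from \<open>p\<close> to
  \<open>p + d\<close>.\<close>

definition quartic_gap :: "'a::real_inner \<Rightarrow> 'a \<Rightarrow> real" where
  "quartic_gap p d = 4 * (p \<bullet> d)\<^sup>2 + (d \<bullet> d)\<^sup>2 + 2 * (p \<bullet> p) * (d \<bullet> d) + 4 * (p \<bullet> d) * (d \<bullet> d)"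

lemma norm_power4: "norm h ^ 4 = (h \<bullet> h)\<^sup>2"
  for h :: "'a::real_inner"
  by (simp add: dot_square_norm power_mult[symmetric])

lemma norm_power4_add:
  fixes p d :: "'a::real_inner"
  shows "norm (p + d) ^ 4 = norm p ^ 4 + 4 * (p \<bullet> p) * (p \<bullet> d) + quartic_gap p d"
  by (simp add: norm_power4 quartic_gap_def inner_commute[of d p] algebra_simps power2_eq_square)

text \<open>After Cauchy-Schwarz, completing the square in \<open>p \<bullet> d\<close> leaves a
  third of \<open>(d \<bullet> d)\<^sup>2\<close>. This uniform convexity is what lets Bregman
  distances control step lengths.\<close>

lemma quartic_gap_ge: "(d \<bullet> d)\<^sup>2 / 3 \<le> quartic_gap p d"
proof -
  have "(p \<bullet> d)\<^sup>2 \<le> (p \<bullet> p) * (d \<bullet> d)"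
    by (rule Cauchy_Schwarz_ineq)
  moreover have "0 \<le> 6 * (p \<bullet> d + (d \<bullet> d) / 3)\<^sup>2" by simp
  ultimately show ?thesis
    by (simp add: quartic_gap_def power2_eq_square algebra_simps)
qed

lemma quartic_gap_nonneg: "0 \<le> quartic_gap p d"
  using quartic_gap_ge[of d p] by (smt (verit) divide_nonneg_nonneg zero_le_power2)

text \<open>The difference is an explicit sum of squares. The vector p + d/3 is the first argument
  of the third derivative in \<open>bregman_Omega\<close>.\<close>

lemma quartic_gap_shift:
  "2 * ((p + d /\<^sub>R 3) \<bullet> (p + d /\<^sub>R 3)) * (d \<bullet> d) \<le> quartic_gap p d"
proof -
  have "0 \<le> 4 * (p \<bullet> d + (d \<bullet> d) / 3)\<^sup>2 + (d \<bullet> d)\<^sup>2 / 3" by simp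
  also have "\<dots> = quartic_gap p d - 2 * ((p + d /\<^sub>R 3) \<bullet> (p + d /\<^sub>R 3)) * (d \<bullet> d)"
    by (simp add: quartic_gap_def inner_commute[of d p] power2_eq_square algebra_simps divide_simps)
  finally show ?thesis by simp
qed

lemma norm_le_if_inner_le:
  fixes w :: "'a::real_inner"
  assumes "\<And>k. w \<bullet> k \<le> c * norm k" and "0 \<le> c"
  shows "norm w \<le> c"
proof (cases "w = 0")
  case False
  have "norm w * norm w \<le> c * norm w"
    using assms(1)[of w] by (simp add: dot_square_norm power2_eq_square)
  with False show ?thesis by simp
qed (simp add: assms)

lemma psd_form_Cauchy_Schwarz:
  fixes S :: "'a::real_vector \<Rightarrow> 'a \<Rightarrow> real"
  assumes S: "bilinear S" and sym: "\<And>u v. S u v = S v u" and psd: "\<And>e. 0 \<le> S e e"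
  shows "(S d k)\<^sup>2 \<le> S d d * S k k"
proof -
  have expand: "0 \<le> S d d + 2 * t * S d k + t\<^sup>2 * S k k" for t
    using psd[of "d + t *\<^sub>R k"] sym[of k d] S
    by (simp add: bilinear_ladd bilinear_radd bilinear_lmul bilinear_rmul power2_eq_square algebra_simps)
  show ?thesis
  proof (cases "S k k = 0")
    case True
    have "S d k = 0"
    proof (rule ccontr)
      assume nz: "S d k \<noteq> 0"
      \<comment> \<open>With \<open>S k k = 0\<close> the quadratic in \<open>t\<close> is affine;
        at this \<open>t\<close> it takes the value -1.\<close>
      have "2 * (- (S d d + 1) / (2 * S d k)) * S d k = - (S d d + 1)"
        using nz by simp
      with expand[of "- (S d d + 1) / (2 * S d k)"] True show False by simp
    qed
    with True show ?thesis by simp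
  next
    case False
    then have pos: "0 < S k k" using psd[of k] by simp
    have "0 \<le> S k k * (S d d + 2 * (- S d k / S k k) * S d k + (- S d k / S k k)\<^sup>2 * S k k)"
      by (rule mult_nonneg_nonneg[OF psd expand])
    also have "\<dots> = S d d * S k k - (S d k)\<^sup>2"
      using pos by (simp add: field_simps power2_eq_square)
    finally show ?thesis by simp
  qed
qed

text \<open>Off-diagonal entries are at most \<open>a i * a j\<close>, with \<open>a i\<close> the
  root of a diagonal entry, so the form is dominated by the square of one scalar product;
  Cauchy-Schwarz then produces the trace.\<close>

lemma psd_form_le_trace:
  fixes S :: "real^'n \<Rightarrow> real^'n \<Rightarrow> real"
  assumes S: "bilinear S" and sym: "\<And>u v. S u v = S v u" and psd: "\<And>e. 0 \<le> S e e"
  shows "S d d \<le> (\<Sum>i\<in>UNIV. S (axis i 1) (axis i 1)) * (d \<bullet> d)"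
proof -
  define a where "a i = sqrt (S (axis i 1) (axis i 1))" for i
  have offdiag: "\<bar>S (axis i 1) (axis j 1)\<bar> \<le> a i * a j" for i j
    using real_sqrt_le_mono[OF psd_form_Cauchy_Schwarz[OF assms, of "axis i 1" "axis j 1"]]
    by (simp add: a_def real_sqrt_mult)
  have d: "(\<Sum>i\<in>UNIV. d $ i *\<^sub>R axis i 1) = d"
    by (simp add: vec_eq_iff axis_def if_distrib cong: if_cong)
  have "S d d = S (\<Sum>i\<in>UNIV. d $ i *\<^sub>R axis i 1) (\<Sum>j\<in>UNIV. d $ j *\<^sub>R axis j 1)"
    by (simp only: d)
  also have "\<dots> = (\<Sum>(i, j)\<in>UNIV \<times> UNIV. d $ i * (d $ j * S (axis i 1) (axis j 1)))"
    using S by (subst bilinear_sum) (simp_all add: bilinear_lmul bilinear_rmul)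
  also have "\<dots> \<le> (\<Sum>(i, j)\<in>UNIV \<times> UNIV. (\<bar>d $ i\<bar> * a i) * (\<bar>d $ j\<bar> * a j))"
  proof (rule sum_mono, clarify)
    fix i j
    have "d $ i * (d $ j * S (axis i 1) (axis j 1)) \<le> \<bar>d $ i\<bar> * (\<bar>d $ j\<bar> * \<bar>S (axis i 1) (axis j 1)\<bar>)"
      by (metis abs_ge_self abs_mult)
    also have "\<dots> \<le> \<bar>d $ i\<bar> * (\<bar>d $ j\<bar> * (a i * a j))"
      by (intro mult_left_mono offdiag) auto
    finally show "d $ i * (d $ j * S (axis i 1) (axis j 1)) \<le> (\<bar>d $ i\<bar> * a i) * (\<bar>d $ j\<bar> * a j)"
      by (simp add: mult_ac)
  qed
  also have "\<dots> = (\<Sum>i\<in>UNIV. \<bar>d $ i\<bar> * a i)\<^sup>2"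
    by (simp add: power2_eq_square sum_product sum.cartesian_product)
  also have "\<dots> \<le> (\<Sum>i\<in>UNIV. \<bar>d $ i\<bar>\<^sup>2) * (\<Sum>i\<in>UNIV. (a i)\<^sup>2)"
    by (rule Cauchy_Schwarz_ineq_sum)
  also have "\<dots> = (\<Sum>i\<in>UNIV. S (axis i 1) (axis i 1)) * (d \<bullet> d)"
    using psd by (simp add: a_def inner_vec_def power2_eq_square)
  finally show ?thesis .
qed

section \<open>Gradients and Bregman distances of the model and its reference function\<close>

context lipschitz_third_derivative
begin

lemma D2_bilinear: "bilinear (\<lambda>u v. D2 f x u v)"
  by (simp add: bilinear_def linear_iff blinfun.bilinear_simps)

lemma trace_hessian: "trace (hessian f x) = (\<Sum>i\<in>UNIV. D2 f x (axis i 1) (axis i 1))"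
  by (simp add: trace_def hessian_def)

lemma trace_hessian_nonneg: "0 \<le> trace (hessian f x)"
  unfolding trace_hessian by (intro sum_nonneg D2_nonneg)

lemma D2_le_trace: "D2 f x d d \<le> trace (hessian f x) * (d \<bullet> d)"
  unfolding trace_hessian by (rule psd_form_le_trace[OF D2_bilinear D2_sym D2_nonneg])

lemma hessian_inner: "(hessian f x *v u) \<bullet> w = D2 f x u w"
proof -
  have e: "(\<Sum>i\<in>UNIV. v $ i *\<^sub>R axis i 1) = v" for v :: "real^'n"
    by (simp add: vec_eq_iff axis_def if_distrib cong: if_cong)
  \<comment> \<open>The matrix product contracts the second slot of \<open>D2 f x\<close> with
    \<open>u\<close>, hence the swap.\<close>
  have "D2 f x u w = D2 f x w u"
    by (rule D2_sym)
  also have "\<dots> = D2 f x (\<Sum>i\<in>UNIV. w $ i *\<^sub>R axis i 1) (\<Sum>j\<in>UNIV. u $ j *\<^sub>R axis j 1)"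
    by (simp only: e)
  also have "\<dots> = (\<Sum>j\<in>UNIV. \<Sum>i\<in>UNIV. w $ i * (u $ j * D2 f x (axis i 1) (axis j 1)))"
    by (simp add: mult.left_commute blinfun.bilinear_simps blinfun.sum_left blinfun.sum_right sum_distrib_left)
  also have "\<dots> = (\<Sum>i\<in>UNIV. \<Sum>j\<in>UNIV. w $ i * (u $ j * D2 f x (axis i 1) (axis j 1)))"
    by (subst sum.swap) simp
  also have "\<dots> = (hessian f x *v u) \<bullet> w"
    by (simp add: inner_vec_def matrix_vector_mult_def hessian_def sum_distrib_left sum_distrib_right mult_ac)
  finally show ?thesis ..
qed

lemma rho_eq: "rho f M x y = 1 / 2 * D2 f x (y - x) (y - x) + M / 8 * norm (y - x) ^ 4"
  by (simp add: rho_def hessian_inner)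

lemma norm_power4_deriv:
  "((\<lambda>y. norm (y - x) ^ 4) has_derivative (\<lambda>k. 4 * ((y - x) \<bullet> (y - x)) * ((y - x) \<bullet> k))) (at y)"
  for x y :: "'a::real_inner"
  unfolding norm_power4
  by (auto intro!: derivative_eq_intros simp: inner_commute algebra_simps fun_eq_iff)

lemma D2_quadratic_deriv:
  "((\<lambda>y. D2 f x (y - x) (y - x)) has_derivative (\<lambda>k. 2 * D2 f x (y - x) k)) (at y)"
  by (auto intro!: derivative_eq_intros simp: D2_sym[of x _ "y - x"] fun_eq_iff)

lemma rho_deriv:
  "(rho f M x has_derivative (\<lambda>k. D2 f x (y - x) k + M / 2 * ((y - x) \<bullet> (y - x)) * ((y - x) \<bullet> k))) (at y)"
proof -
  have "((\<lambda>y. 1 / 2 * D2 f x (y - x) (y - x) + M / 8 * norm (y - x) ^ 4) has_derivative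
    (\<lambda>k. 1 / 2 * (2 * D2 f x (y - x) k) + M / 8 * (4 * ((y - x) \<bullet> (y - x)) * ((y - x) \<bullet> k)))) (at y)"
    by (intro has_derivative_add has_derivative_mult_right D2_quadratic_deriv norm_power4_deriv)
  then show ?thesis
    unfolding rho_eq[abs_def] by (simp add: mult_ac)
qed

lemma Omega_eq:
  "Omega f M x y = f x + D1 f x (y - x) + 1 / 2 * D2 f x (y - x) (y - x)
    + 1 / 6 * D3 f x (y - x) (y - x) (y - x) + M / 8 * norm (y - x) ^ 4"
  by (simp add: Omega_def Phi_def Let_def)

lemma D3_sym13: "D3 f x u v w = D3 f x w v u"
  by (metis D3_sym12 D3_sym23)

lemma D3_cubic_deriv:
  "((\<lambda>y. D3 f x (y - x) (y - x) (y - x)) has_derivative (\<lambda>k. 3 * D3 f x (y - x) (y - x) k)) (at y)"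
  by (auto intro!: derivative_eq_intros
      simp: blinfun.add_left D3_sym13[of x _ "y - x" "y - x"] D3_sym23[of x "y - x" _ "y - x"] fun_eq_iff)

lemma Omega_deriv:
  "(Omega f M x has_derivative (\<lambda>k. D1 f x k + D2 f x (y - x) k + 1 / 2 * D3 f x (y - x) (y - x) k
    + M / 2 * ((y - x) \<bullet> (y - x)) * ((y - x) \<bullet> k))) (at y)"
proof -
  have lin: "((\<lambda>y. D1 f x (y - x)) has_derivative (\<lambda>k. D1 f x k)) (at y)"
    by (auto intro!: derivative_eq_intros)
  have "((\<lambda>y. f x + D1 f x (y - x) + 1 / 2 * D2 f x (y - x) (y - x)
    + 1 / 6 * D3 f x (y - x) (y - x) (y - x) + M / 8 * norm (y - x) ^ 4) has_derivative
    (\<lambda>k. 0 + D1 f x k + 1 / 2 * (2 * D2 f x (y - x) k) + 1 / 6 * (3 * D3 f x (y - x) (y - x) k)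
      + M / 8 * (4 * ((y - x) \<bullet> (y - x)) * ((y - x) \<bullet> k)))) (at y)"
    by (intro has_derivative_add has_derivative_mult_right has_derivative_const lin
        D2_quadratic_deriv D3_cubic_deriv norm_power4_deriv)
  then show ?thesis
    unfolding Omega_eq[abs_def] by (simp add: mult_ac)
qed

lemma gradient_rho_inner:
  "gradient (rho f M x) y \<bullet> k = D2 f x (y - x) k + M / 2 * ((y - x) \<bullet> (y - x)) * ((y - x) \<bullet> k)"
  by (rule gradient_inner[OF rho_deriv])

lemma gradient_Omega_inner:
  "gradient (Omega f M x) y \<bullet> k = D1 f x k + D2 f x (y - x) k + 1 / 2 * D3 f x (y - x) (y - x) k
    + M / 2 * ((y - x) \<bullet> (y - x)) * ((y - x) \<bullet> k)"
  by (rule gradient_inner[OF Omega_deriv])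

lemma bregman_rho:
  "bregman (rho f M x) u v = 1 / 2 * D2 f x (v - u) (v - u) + M / 8 * quartic_gap (u - x) (v - u)"
proof -
  define p d where "p = u - x" and "d = v - u"
  have v: "v - x = p + d" by (simp add: p_def d_def)
  show ?thesis
    unfolding bregman_def gradient_rho_inner rho_eq v p_def[symmetric] d_def[symmetric] norm_power4_add
    using D2_sym[of x d p] by (simp add: blinfun.bilinear_simps algebra_simps)
qed

text \<open>Expanding the cubic about p = u - x leaves T[p,d,d]/2 + T[d,d,d]/6, where d = v - u.
  Merging both into one quadratic form in d makes \<open>D3_bound\<close> applicable.\<close>

lemma bregman_Omega:
  "bregman (Omega f M x) u v = 1 / 2 * D2 f x (v - u) (v - u)
    + 1 / 2 * D3 f x ((u - x) + (v - u) /\<^sub>R 3) (v - u) (v - u) + M / 8 * quartic_gap (u - x) (v - u)"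
proof -
  define p d where "p = u - x" and "d = v - u"
  have v: "v - x = p + d" by (simp add: p_def d_def)
  show ?thesis
    unfolding bregman_def gradient_Omega_inner Omega_eq v p_def[symmetric] d_def[symmetric] norm_power4_add
    using D2_sym[of x d p] D3_sym23[of x p d p] D3_sym13[of x d p p] D3_sym12[of x d p d] D3_sym13[of x d d p]
    by (simp add: blinfun.bilinear_simps algebra_simps)
qed

lemma bregman_rho_nonneg: "0 \<le> M \<Longrightarrow> 0 \<le> bregman (rho f M x) u v"
  unfolding bregman_rho by (simp add: D2_nonneg quartic_gap_nonneg)

lemma bregman_rho_ge:
  assumes "0 \<le> M"
  shows "M / 24 * norm (v - u) ^ 4 \<le> bregman (rho f M x) u v"
  unfolding bregman_rho norm_power4
  using mult_left_mono[OF quartic_gap_ge[of "v - u" "u - x"], of "M / 8"] D2_nonneg[of x "v - u"] assms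
  by simp

lemma bregman_self: "bregman h u u = 0"
  by (simp add: bregman_def)

lemma bregman_rho_center: "bregman (rho f M x) x v = rho f M x v"
  by (simp add: bregman_rho rho_eq quartic_gap_def norm_power4)

lemma bregman_three_point:
  "bregman h u y - bregman h u z - bregman h z y = (gradient h z - gradient h u) \<bullet> (y - z)"
  by (simp add: bregman_def algebra_simps)

lemma D3_shift_bound:
  assumes "0 < \<tau>"
  shows "\<bar>D3 f x (p + d /\<^sub>R 3) d d\<bar> \<le> D2 f x d d / \<tau> + \<tau> * L / 4 * quartic_gap p d"
proof -
  have "\<tau> * L / 4 * (2 * ((p + d /\<^sub>R 3) \<bullet> (p + d /\<^sub>R 3)) * (d \<bullet> d)) \<le> \<tau> * L / 4 * quartic_gap p d"
    using assms L_nonneg by (intro mult_left_mono quartic_gap_shift) auto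
  then have "\<tau> * L / 2 * ((p + d /\<^sub>R 3) \<bullet> (p + d /\<^sub>R 3)) * (d \<bullet> d) \<le> \<tau> * L / 4 * quartic_gap p d"
    by (simp only: mult_ac times_divide_eq_left times_divide_eq_right)
  with D3_bound[OF assms, of x "p + d /\<^sub>R 3" d] show ?thesis by linarith
qed

text \<open>Relative smoothness. With \<tau> = 1 the distance is at most H[d,d] + (L + M)/8 times
  the quartic gap, well within three times that of \<open>rho\<close>.\<close>

lemma bregman_Omega_le:
  assumes M: "4 * L \<le> M"
  shows "bregman (Omega f M x) u v \<le> 3 * bregman (rho f M x) u v"
proof -
  have "L * quartic_gap (u - x) (v - u) \<le> M * quartic_gap (u - x) (v - u)"
    "0 \<le> M * quartic_gap (u - x) (v - u)"
    using M L_nonneg quartic_gap_nonneg[of "u - x" "v - u"] by (auto intro!: mult_right_mono mult_nonneg_nonneg)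
  then show ?thesis
    using D3_shift_bound[of 1 x "u - x" "v - u"] D2_nonneg[of x "v - u"]
    unfolding bregman_Omega bregman_rho by (simp add: abs_le_iff field_simps)
qed

text \<open>Relative strong convexity. With \<tau> = 2 the cubic costs half of the Hessian part and
  L/4 of the quartic gap; keeping M/16 of the available M/8 is the source of the threshold
  \<open>4 * L\<close>.\<close>

lemma bregman_Omega_ge:
  assumes M: "4 * L \<le> M"
  shows "1 / 2 * bregman (rho f M x) u v \<le> bregman (Omega f M x) u v"
proof -
  have "4 * L * quartic_gap (u - x) (v - u) \<le> M * quartic_gap (u - x) (v - u)"
    using M quartic_gap_nonneg by (intro mult_right_mono)
  then show ?thesis
    using D3_shift_bound[of 2 x "u - x" "v - u"]
    unfolding bregman_Omega bregman_rho by (simp add: abs_le_iff field_simps)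
qed

lemma f_le_Omega: "f y + (M / 8 - L / 24) * norm (y - x) ^ 4 \<le> Omega f M x y"
proof -
  have "x + (y - x) = y" by simp
  then show ?thesis
    using f_taylor[of x "y - x", THEN abs_le_D1] unfolding Omega_eq left_diff_distrib by simp
qed

text \<open>Adding back the gradient of the quartic term leaves the gradient of the Taylor
  polynomial, so this is the remainder bound \<open>D1_taylor\<close> tested against all
  directions.\<close>

lemma gradient_f_Omega:
  "norm (gradient f y - gradient (Omega f M x) y + (M / 2 * (norm (y - x))\<^sup>2) *\<^sub>R (y - x))
    \<le> L / 6 * norm (y - x) ^ 3"
proof (rule norm_le_if_inner_le)
  fix k
  have "(gradient f y - gradient (Omega f M x) y + (M / 2 * (norm (y - x))\<^sup>2) *\<^sub>R (y - x)) \<bullet> k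
    = D1 f y k - D1 f x k - D2 f x (y - x) k - 1 / 2 * D3 f x (y - x) (y - x) k"
    by (simp add: inner_diff_left inner_add_left gradient_f_inner gradient_Omega_inner dot_square_norm)
  also have "\<dots> \<le> L / 6 * norm (y - x) ^ 3 * norm k"
    using D1_taylor[of 1 x "y - x" k, THEN abs_le_D1] by simp
  finally show "(gradient f y - gradient (Omega f M x) y + (M / 2 * (norm (y - x))\<^sup>2) *\<^sub>R (y - x)) \<bullet> k
    \<le> L / 6 * norm (y - x) ^ 3 * norm k" .
qed (use L_nonneg in simp)

text \<open>The residual of the inner method is the difference of this map at two consecutive
  iterates. When \<open>R\<close> is the radius of the iterates, the factor is three times
  \<open>L_const\<close>.\<close>

lemma surrogate_gradient_lipschitz:
  assumes M: "4 * L \<le> M" and u: "norm (u - x) \<le> R" and v: "norm (v - x) \<le> R"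
  shows "norm ((3 *\<^sub>R gradient (rho f M x) u - gradient (Omega f M x) u)
      - (3 *\<^sub>R gradient (rho f M x) v - gradient (Omega f M x) v))
    \<le> 3 * (trace (hessian f x) + 3 * M / 2 * R\<^sup>2) * norm (u - v)" (is "norm ?w \<le> ?C * _")
proof (rule norm_le_if_inner_le)
  have M0: "0 \<le> M" using M L_nonneg by simp
  have R: "0 \<le> R" using u norm_ge_zero order_trans by blast
  \<comment> \<open>The midpoint \<open>m\<close> factors the cubic part: T[p,p,k] - T[q,q,k] = 2
    T[m,d,k]. The remaining non-quartic terms then form the symmetric form \<open>S\<close>, whose
    quadratic form is bounded by \<open>D3_bound\<close>.\<close>
  define p q d m where "p = u - x" and "q = v - x" and "d = u - v" and "m = (p + q) /\<^sub>R 2"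
  have pq: "norm p \<le> R" "norm q \<le> R" and d: "d = p - q"
    using u v by (simp_all add: p_def q_def d_def)
  have m: "norm m \<le> R"
    using norm_triangle_ineq[of p q] pq by (simp add: m_def)
  define S where "S a b = 2 * D2 f x a b - D3 f x m a b" for a b
  have "bilinear S"
    by (simp add: S_def bilinear_def linear_iff blinfun.bilinear_simps algebra_simps)
  moreover have "S a b = S b a" for a b
    using D2_sym[of x a b] D3_sym23[of x m a b] by (simp add: S_def)
  moreover have "\<bar>S e e\<bar> \<le> (3 * trace (hessian f x) + L / 2 * R\<^sup>2) * (e \<bullet> e)" for e
  proof -
    have "m \<bullet> m \<le> R\<^sup>2"
      using m by (simp add: dot_square_norm power_mono)
    then have "1 * L / 2 * (m \<bullet> m) * (e \<bullet> e) \<le> L / 2 * R\<^sup>2 * (e \<bullet> e)"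
      using L_nonneg by (simp add: mult_right_mono mult_left_mono)
    then show ?thesis
      using D3_bound[of 1 x m e] D2_nonneg[of x e] D2_le_trace[of x e]
      unfolding S_def distrib_right by linarith
  qed
  ultimately have S: "\<bar>S d k\<bar> \<le> (3 * trace (hessian f x) + L / 2 * R\<^sup>2) * norm d * norm k" for k
    by (rule bilinear_bound_from_quadratic)
  fix k
  have quartic: "(p \<bullet> p) * (p \<bullet> k) - (q \<bullet> q) * (q \<bullet> k) \<le> 3 * R\<^sup>2 * norm d * norm k"
  proof -
    have "(p \<bullet> p) * (p \<bullet> k) - (q \<bullet> q) * (q \<bullet> k) = (p \<bullet> p) * (d \<bullet> k) + ((p + q) \<bullet> d) * (q \<bullet> k)"
      by (simp add: d inner_commute[of q p] algebra_simps)
    also have "\<dots> \<le> \<bar>p \<bullet> p\<bar> * \<bar>d \<bullet> k\<bar> + \<bar>(p + q) \<bullet> d\<bar> * \<bar>q \<bullet> k\<bar>"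
      by (metis abs_ge_self abs_mult add_mono)
    also have "\<dots> \<le> (R * R) * (norm d * norm k) + ((R + R) * norm d) * (R * norm k)"
    proof (intro add_mono mult_mono)
      show "\<bar>p \<bullet> p\<bar> \<le> R * R"
        using pq R by (simp add: dot_square_norm power2_eq_square mult_mono)
      have "\<bar>(p + q) \<bullet> d\<bar> \<le> norm (p + q) * norm d"
        by (rule Cauchy_Schwarz_ineq2)
      also have "\<dots> \<le> (R + R) * norm d"
        using norm_triangle_ineq[of p q] pq by (intro mult_right_mono) auto
      finally show "\<bar>(p + q) \<bullet> d\<bar> \<le> (R + R) * norm d" .
      show "\<bar>q \<bullet> k\<bar> \<le> R * norm k"
        using Cauchy_Schwarz_ineq2[of q k] pq(2) by (meson mult_right_mono norm_ge_zero order_trans)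
    qed (use R in \<open>auto intro: Cauchy_Schwarz_ineq2\<close>)
    finally show ?thesis by (simp add: power2_eq_square algebra_simps)
  qed
  have "?w \<bullet> k = 2 * D2 f x d k - 1 / 2 * (D3 f x p p k - D3 f x q q k)
      + M * ((p \<bullet> p) * (p \<bullet> k) - (q \<bullet> q) * (q \<bullet> k))"
    unfolding inner_diff_left inner_scaleR_left gradient_rho_inner gradient_Omega_inner
      p_def[symmetric] q_def[symmetric] d
    by (simp add: blinfun.bilinear_simps algebra_simps)
  also have "D3 f x p p k - D3 f x q q k = 2 * D3 f x m d k"
    using D3_sym12[of x p q k] by (simp add: m_def d blinfun.bilinear_simps field_simps)
  also have "2 * D2 f x d k - 1 / 2 * (2 * D3 f x m d k) = S d k"
    by (simp add: S_def)
  also have "S d k + M * ((p \<bullet> p) * (p \<bullet> k) - (q \<bullet> q) * (q \<bullet> k))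
      \<le> (3 * trace (hessian f x) + L / 2 * R\<^sup>2) * norm d * norm k + M * (3 * R\<^sup>2 * norm d * norm k)"
    using S[of k] mult_left_mono[OF quartic M0] by linarith
  also have "\<dots> = (3 * trace (hessian f x) + (L / 2 + 3 * M) * R\<^sup>2) * (norm d * norm k)"
    by (simp add: algebra_simps)
  also have "\<dots> \<le> ?C * (norm d * norm k)"
  proof (rule mult_right_mono)
    \<comment> \<open>L/2 + 3M is at most 9M/2 because \<open>4 * L \<le> M\<close>.\<close>
    have "(L / 2 + 3 * M) * R\<^sup>2 \<le> (3 * (3 * M / 2)) * R\<^sup>2"
      using M M0 by (intro mult_right_mono) auto
    then show "3 * trace (hessian f x) + (L / 2 + 3 * M) * R\<^sup>2 \<le> ?C"
      by simp
  qed simp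
  finally show "?w \<bullet> k \<le> ?C * norm (u - v) * norm k"
    by (simp add: d_def mult_ac)
next
  show "0 \<le> ?C * norm (u - v)"
    using M L_nonneg trace_hessian_nonneg[of x] by (intro mult_nonneg_nonneg add_nonneg_nonneg) auto
qed

end

section \<open>The composite objective and the iterates of the inner method\<close>

locale composite_problem = lipschitz_third_derivative f L
  for f :: "real^'n \<Rightarrow> real" and L :: real +
  fixes \<psi> :: "real^'n \<Rightarrow> ereal"
  assumes psi_convex: "econvex \<psi>" and psi_simple: "simple_for f \<psi>"
begin

text \<open>Meaningful only on the effective domain: an infinite value is sent to 0.\<close>

definition psi_real :: "real^'n \<Rightarrow> real" where
  "psi_real x = real_of_ereal (\<psi> x)"

definition F :: "real^'n \<Rightarrow> real" where
  "F x = f x + psi_real x"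

lemma psi_eq: "x \<in> eff_dom \<psi> \<Longrightarrow> \<psi> x = ereal (psi_real x)"
  using psi_convex unfolding eff_dom_def econvex_def psi_real_def
  by (cases "\<psi> x") auto

lemma ftilde_eq: "x \<in> eff_dom \<psi> \<Longrightarrow> ftilde f \<psi> x = ereal (F x)"
  by (simp add: ftilde_def F_def psi_eq)

lemma ftilde_dom: "eff_dom (ftilde f \<psi>) = eff_dom \<psi>"
  unfolding eff_dom_def ftilde_def by auto

lemma ftilde_infinite: "x \<notin> eff_dom \<psi> \<Longrightarrow> ftilde f \<psi> x = \<infinity>"
  by (simp add: eff_dom_def ftilde_def)

lemma subdifferential_ftilde:
  "g \<in> subdifferential (ftilde f \<psi>) x \<longleftrightarrow>
    x \<in> eff_dom \<psi> \<and> (\<forall>y\<in>eff_dom \<psi>. F x + g \<bullet> (y - x) \<le> F y)"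
proof -
  have "ftilde f \<psi> x + ereal (g \<bullet> (y - x)) \<le> ftilde f \<psi> y
      \<longleftrightarrow> (y \<in> eff_dom \<psi> \<longrightarrow> F x + g \<bullet> (y - x) \<le> F y)" if "x \<in> eff_dom \<psi>" for y
    using that by (cases "y \<in> eff_dom \<psi>") (simp_all add: ftilde_eq ftilde_infinite)
  then show ?thesis
    unfolding subdifferential_def ftilde_dom by blast
qed

lemma psi_real_convex:
  assumes "y \<in> eff_dom \<psi>" "z \<in> eff_dom \<psi>" "0 < t" "t < 1"
  shows "z + t *\<^sub>R (y - z) \<in> eff_dom \<psi>"
    and "psi_real (z + t *\<^sub>R (y - z)) \<le> t * psi_real y + (1 - t) * psi_real z"
proof -
  have "z + t *\<^sub>R (y - z) = t *\<^sub>R y + (1 - t) *\<^sub>R z"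
    by (simp add: algebra_simps)
  then have le: "\<psi> (z + t *\<^sub>R (y - z)) \<le> ereal (t * psi_real y + (1 - t) * psi_real z)"
    using psi_convex assms unfolding econvex_def by (metis psi_eq plus_ereal.simps(1) times_ereal.simps(1))
  then show dom: "z + t *\<^sub>R (y - z) \<in> eff_dom \<psi>"
    unfolding eff_dom_def using le_less_trans by fastforce
  show "psi_real (z + t *\<^sub>R (y - z)) \<le> t * psi_real y + (1 - t) * psi_real z"
    using le psi_eq[OF dom] by simp
qed

abbreviation iter :: "real \<Rightarrow> real^'n \<Rightarrow> nat \<Rightarrow> real^'n" where
  "iter \<equiv> inner_iter f \<psi>"

text \<open>\<open>arg_min\<close> is a choice operator; \<open>simple_for\<close> supplies the
  existence that makes the chosen point a minimizer.\<close>

lemma iter_Suc_arg_min: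
  assumes "x \<in> eff_dom \<psi>" "iter M x k \<in> eff_dom \<psi>" "0 < M"
  shows "inner_obj f \<psi> M x (iter M x k) (iter M x (Suc k)) \<le> inner_obj f \<psi> M x (iter M x k) w"
proof -
  have "is_arg_min (inner_obj f \<psi> M x (iter M x k)) (\<lambda>_. True) (iter M x (Suc k))"
    using psi_simple assms unfolding simple_for_def inner_iter.simps arg_min_def
    by (meson someI_ex)
  then show ?thesis
    by (auto simp: is_arg_min_def not_less)
qed

lemma iter_in_dom:
  assumes "x \<in> eff_dom \<psi>" "0 < M"
  shows "iter M x k \<in> eff_dom \<psi>"
proof (induction k)
  case (Suc k)
  \<comment> \<open>Comparison with the previous iterate, where the objective is finite.\<close>
  have "inner_obj f \<psi> M x (iter M x k) (iter M x (Suc k)) < \<infinity>"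
    by (rule le_less_trans[OF iter_Suc_arg_min[OF assms(1) Suc assms(2), of "iter M x k"]])
      (simp add: inner_obj_def psi_eq[OF Suc])
  then show ?case
    unfolding inner_obj_def eff_dom_def by auto
qed (simp add: assms)

text \<open>Optimality condition of the inner problem: \<open>inner_gpsi\<close> is minus the
  gradient of the smooth part \<open>h\<close> at the minimizer, and comparing the minimizer with
  points on the segment to \<open>y\<close> bounds its directional derivative.\<close>

lemma inner_gpsi_subgradient:
  assumes x: "x \<in> eff_dom \<psi>" and M: "0 < M" and y: "y \<in> eff_dom \<psi>"
  shows "psi_real (iter M x (Suc k)) + inner_gpsi f \<psi> M x k \<bullet> (y - iter M x (Suc k)) \<le> psi_real y"
proof -
  define u z where "u = iter M x k" and "z = iter M x (Suc k)"
  have u: "u \<in> eff_dom \<psi>" and z: "z \<in> eff_dom \<psi>"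
    unfolding u_def z_def by (rule iter_in_dom[OF x M])+
  define h where "h w = gradient (Omega f M x) u \<bullet> (w - u) + 3 * bregman (rho f M x) u w" for w
  have min: "h z + psi_real z \<le> h w + psi_real w" if "w \<in> eff_dom \<psi>" for w
    using iter_Suc_arg_min[OF x _ M, of k w] u that z
    unfolding inner_obj_def h_def u_def[symmetric] z_def[symmetric] by (simp add: psi_eq)
  have rho': "(rho f M x has_derivative (\<lambda>k. gradient (rho f M x) z \<bullet> k)) (at z)"
    using rho_deriv[of M x z] by (simp add: gradient_rho_inner)
  have gpsi: "inner_gpsi f \<psi> M x k
      = - gradient (Omega f M x) u + 3 *\<^sub>R (gradient (rho f M x) u - gradient (rho f M x) z)"
    unfolding inner_gpsi_def Let_def u_def z_def ..
  have "((\<lambda>w. - h w) has_derivative (\<lambda>d. inner_gpsi f \<psi> M x k \<bullet> d)) (at z)"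
    unfolding h_def bregman_def gpsi
    by (auto intro!: derivative_eq_intros rho' simp: fun_eq_iff algebra_simps)
  then have "inner_gpsi f \<psi> M x k \<bullet> (y - z) \<le> psi_real y - psi_real z"
  proof (rule directional_derivative_le)
    fix t :: real assume t: "0 < t" "t < 1"
    show "- h (z + t *\<^sub>R (y - z)) - - h z \<le> t * (psi_real y - psi_real z)"
      using min[OF psi_real_convex(1)[OF y z t]] psi_real_convex(2)[OF y z t]
      by (simp add: algebra_simps)
  qed
  then show ?thesis by (simp add: z_def)
qed

lemma output_subgradient:
  assumes "x \<in> eff_dom \<psi>" "0 < M"
  shows "gradient f (iter M x (Suc k)) + inner_gpsi f \<psi> M x k
    \<in> subdifferential (ftilde f \<psi>) (iter M x (Suc k))"
  unfolding subdifferential_ftilde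
proof (intro conjI ballI)
  fix y assume "y \<in> eff_dom \<psi>"
  with inner_gpsi_subgradient[OF assms this, of k] f_above_tangent[of "iter M x (Suc k)" y]
  show "F (iter M x (Suc k)) + (gradient f (iter M x (Suc k)) + inner_gpsi f \<psi> M x k)
      \<bullet> (y - iter M x (Suc k)) \<le> F y"
    unfolding F_def inner_add_left by linarith
qed (rule iter_in_dom[OF assms])

end

section \<open>Convergence of the inner method\<close>

lemma power_powr_eq: "0 < c \<Longrightarrow> (c ^ n) powr a = c powr (real n * a)" for c a :: real
  by (metis powr_powr powr_realpow)

lemma powr_third_powers:
  "a powr (2 / 3) = (a powr (1 / 3))\<^sup>2" "a powr (4 / 3) = (a powr (1 / 3)) ^ 4" for a :: real
  using powr_power[of a "1 / 3" 2] powr_power[of a "1 / 3" 4] by (cases "a = 0"; simp)+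

lemma le_powr_third_if_cube_le:
  fixes r a :: real
  assumes "0 \<le> r" "r ^ 3 \<le> a"
  shows "r \<le> a powr (1 / 3)"
proof -
  have "r = (r ^ 3) powr (1 / 3)"
    using assms(1) by (cases "r = 0") (simp_all add: power_powr_eq)
  also have "\<dots> \<le> a powr (1 / 3)"
    using assms by (intro powr_mono2) auto
  finally show ?thesis .
qed

text \<open>Squaring the step relation isolates the inner product: 3/4 |G|^2 + M^2 |h|^6 / 8 is at
  most - M |h|^2 (G . h). A Young-type inequality removes the dependence on |h|.\<close>

lemma decrease_from_step:
  fixes G h :: "'a::real_inner"
  assumes M: "0 < M" and G: "G \<noteq> 0"
    and step: "norm (G + (M / 2 * (norm h)\<^sup>2) *\<^sub>R h) \<le> E"
    and E: "E\<^sup>2 \<le> (norm G)\<^sup>2 / 4 + M\<^sup>2 * norm h ^ 6 / 8"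
  shows "1 / (6 * M powr (1 / 3)) * norm G powr (4 / 3) \<le> - (G \<bullet> h)"
proof -
  define r where "r = norm h"
  \<comment> \<open>The length scale at which M c^3 equals |G|; the target becomes M c^4 /
    6.\<close>
  define c where "c = (norm G / M) powr (1 / 3)"
  have nG: "0 < norm G" using G by simp
  have c: "0 < c" using M nG by (simp add: c_def)
  have c3: "norm G = M * c ^ 3"
    using M nG powr_power[of "norm G / M" "1 / 3" 3] by (simp add: c_def)
  have rhs: "1 / (6 * M powr (1 / 3)) * norm G powr (4 / 3) = M * c ^ 4 / 6"
  proof -
    have "norm G powr (4 / 3) = M powr (4 / 3) * (c ^ 3) powr (4 / 3)"
      using M c by (simp add: c3 powr_mult)
    also have "(c ^ 3) powr (4 / 3) = c ^ 4"
      using c powr_realpow[of c 4] by (simp add: power_powr_eq)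
    also have "M powr (4 / 3) = M * M powr (1 / 3)"
      using M powr_add[of M 1 "1 / 3"] by simp
    finally show ?thesis using M by simp
  qed
  have "(norm (G + (M / 2 * r\<^sup>2) *\<^sub>R h))\<^sup>2 \<le> E\<^sup>2"
    using step unfolding r_def by (intro power_mono) auto
  moreover have "(norm (G + a *\<^sub>R h))\<^sup>2 = (norm G)\<^sup>2 + 2 * a * (G \<bullet> h) + a\<^sup>2 * r\<^sup>2" for a
    unfolding power2_norm_eq_inner r_def by (simp add: inner_commute[of h G] algebra_simps power2_eq_square)
  then have "(norm (G + (M / 2 * r\<^sup>2) *\<^sub>R h))\<^sup>2
      = (norm G)\<^sup>2 + M * r\<^sup>2 * (G \<bullet> h) + M\<^sup>2 * r ^ 6 / 4"
    by (simp add: power_mult_distrib power_divide flip: power_mult power_add)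
  ultimately have main: "3 / 4 * (M * c ^ 3)\<^sup>2 + M\<^sup>2 * r ^ 6 / 8 \<le> M * r\<^sup>2 * (- (G \<bullet> h))"
    using E unfolding c3[symmetric] r_def[symmetric] by (simp add: algebra_simps)
  have r: "0 < r"
  proof (rule ccontr)
    assume "\<not> 0 < r"
    then have "r = 0" by (simp add: r_def)
    with main M c show False by simp
  qed
  \<comment> \<open>Used with a = c^2 and b = |h|^2. The split at b = 4 a lets one of the two cubes
    dominate alone.\<close>
  have poly: "a\<^sup>2 * b / 6 \<le> 3 / 4 * a ^ 3 + b ^ 3 / 8" if "0 < a" "0 < b" for a b :: real
  proof (cases "b \<le> 4 * a")
    case True
    then have "a\<^sup>2 * b \<le> a\<^sup>2 * (4 * a)" using that by (intro mult_left_mono) auto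
    moreover have "0 \<le> a ^ 3" "0 \<le> b ^ 3" using that by auto
    ultimately show ?thesis by (simp add: power3_eq_cube power2_eq_square)
  next
    case False
    then have "a\<^sup>2 * b \<le> (b / 4)\<^sup>2 * b" using that by (intro mult_right_mono power_mono) auto
    moreover have "0 \<le> a ^ 3" "0 \<le> b ^ 3" using that by auto
    ultimately show ?thesis by (simp add: power3_eq_cube power2_eq_square)
  qed
  have "M * r\<^sup>2 * (M * c ^ 4 / 6) = M\<^sup>2 * ((c\<^sup>2)\<^sup>2 * r\<^sup>2 / 6)"
    by (simp add: power2_eq_square power4_eq_xxxx)
  also have "\<dots> \<le> M\<^sup>2 * (3 / 4 * (c\<^sup>2) ^ 3 + (r\<^sup>2) ^ 3 / 8)"
    using poly[of "c\<^sup>2" "r\<^sup>2"] c r by (intro mult_left_mono) auto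
  also have "\<dots> = 3 / 4 * (M * c ^ 3)\<^sup>2 + M\<^sup>2 * r ^ 6 / 8"
    by (simp add: power_mult_distrib algebra_simps flip: power_mult)
  also note main
  finally have "M * c ^ 4 / 6 \<le> - (G \<bullet> h)"
    by (rule mult_left_le_imp_le) (use M r in simp)
  with rhs show ?thesis by simp
qed

context composite_problem
begin

text \<open>The subgradient inequality and the three-point identity at the new iterate. The factor
  5/2 is 3 from the subproblem minus 1/2 from relative strong convexity.\<close>

lemma inner_step:
  assumes x: "x \<in> eff_dom \<psi>" and M: "0 < M" "4 * L \<le> M" and w: "w \<in> eff_dom \<psi>"
  shows "Omega f M x (iter M x (Suc k)) + psi_real (iter M x (Suc k))
    \<le> Omega f M x w + psi_real w + 5 / 2 * bregman (rho f M x) (iter M x k) w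
      - 3 * bregman (rho f M x) (iter M x (Suc k)) w"
proof -
  define u z where "u = iter M x k" and "z = iter M x (Suc k)"
  have gpsi: "inner_gpsi f \<psi> M x k
      = - gradient (Omega f M x) u + 3 *\<^sub>R (gradient (rho f M x) u - gradient (rho f M x) z)"
    unfolding inner_gpsi_def Let_def u_def z_def ..
  have "psi_real z + inner_gpsi f \<psi> M x k \<bullet> (w - z) \<le> psi_real w"
    unfolding z_def by (rule inner_gpsi_subgradient[OF x M(1) w])
  moreover have "inner_gpsi f \<psi> M x k \<bullet> (w - z) = - (gradient (Omega f M x) u \<bullet> (w - z))
      - 3 * (bregman (rho f M x) u w - bregman (rho f M x) u z - bregman (rho f M x) z w)"
    unfolding gpsi bregman_three_point by (simp add: algebra_simps)
  moreover have "Omega f M x z = Omega f M x u + gradient (Omega f M x) u \<bullet> (z - u) + bregman (Omega f M x) u z"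
    "Omega f M x w = Omega f M x u + gradient (Omega f M x) u \<bullet> (w - u) + bregman (Omega f M x) u w"
    by (simp_all add: bregman_def)
  moreover have "gradient (Omega f M x) u \<bullet> (w - u)
      = gradient (Omega f M x) u \<bullet> (w - z) + gradient (Omega f M x) u \<bullet> (z - u)"
    by (simp add: algebra_simps)
  moreover note bregman_Omega_le[OF M(2), of x u z] bregman_Omega_ge[OF M(2), of x u w]
  ultimately have "Omega f M x z + psi_real z \<le> Omega f M x w + psi_real w + 5 / 2 * bregman (rho f M x) u w
      - 3 * bregman (rho f M x) z w"
    by argo
  then show ?thesis unfolding u_def z_def .
qed

text \<open>Taking the current iterate as \<open>w\<close> in \<open>inner_step\<close> makes the
  positive Bregman term vanish.\<close>

lemma inner_decreasing:
  assumes x: "x \<in> eff_dom \<psi>" and M: "0 < M" "4 * L \<le> M" and "j \<le> n"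
  shows "Omega f M x (iter M x n) + psi_real (iter M x n) \<le> Omega f M x (iter M x j) + psi_real (iter M x j)"
  using \<open>j \<le> n\<close>
proof (induction n rule: dec_induct)
  case (step n)
  have "0 \<le> bregman (rho f M x) (iter M x (Suc n)) (iter M x n)"
    using M by (intro bregman_rho_nonneg) auto
  then show ?case
    using inner_step[OF x M iter_in_dom[OF x M(1), of n], of n] step.IH by (simp add: bregman_self)
qed simp

text \<open>Comparing with the last iterate instead of a minimizer of the model makes the existence of
  the latter irrelevant.\<close>

lemma bregman_contraction:
  assumes x: "x \<in> eff_dom \<psi>" and M: "0 < M" "4 * L \<le> M" and "j \<le> n"
  shows "bregman (rho f M x) (iter M x j) (iter M x n) \<le> (5 / 6) ^ j * rho f M x (iter M x n)"
  using \<open>j \<le> n\<close>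
proof (induction j)
  case 0
  then show ?case by (simp add: bregman_rho_center)
next
  case (Suc j)
  \<comment> \<open>The model value at iterate \<open>n\<close> is at most that at iterate
    \<open>Suc j\<close>, so function values cancel and the ratio is (5/2)/3 = 5/6.\<close>
  have "3 * bregman (rho f M x) (iter M x (Suc j)) (iter M x n)
      \<le> 5 / 2 * bregman (rho f M x) (iter M x j) (iter M x n)"
    using inner_step[OF x M iter_in_dom[OF x M(1), of n], of j] inner_decreasing[OF x M Suc.prems]
    by linarith
  with Suc show ?case by simp
qed

text \<open>Iterates never exceed the initial model value \<open>F x\<close>, the model dominates
  \<open>f\<close> plus a quartic, and \<open>g\<close> bounds \<open>F\<close> below by F x - |g|
  r. Hence M r^4 / 96 is at most |g| r, which is the radius built into \<open>L_const\<close> and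
  \<open>beta_const\<close>.\<close>

lemma iter_radius:
  assumes g: "g \<in> subdifferential (ftilde f \<psi>) x" and M: "0 < M" "4 * L \<le> M"
  shows "norm (iter M x k - x) \<le> (96 * norm g / M) powr (1 / 3)"
proof -
  define y r where "y = iter M x k" and "r = norm (y - x)"
  have x: "x \<in> eff_dom \<psi>" using g by (simp add: subdifferential_ftilde)
  have y: "y \<in> eff_dom \<psi>" unfolding y_def by (rule iter_in_dom[OF x M(1)])
  have "F x + g \<bullet> (y - x) \<le> F y"
    using g y by (simp add: subdifferential_ftilde)
  moreover have "Omega f M x y + psi_real y \<le> F x"
    using inner_decreasing[OF x M, of 0 k] by (simp add: y_def F_def Omega_eq)
  moreover have "- (g \<bullet> (y - x)) \<le> norm g * r"
    using Cauchy_Schwarz_ineq2[of g "y - x"] by (simp add: r_def abs_le_iff)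
  ultimately have "(M / 8 - L / 24) * r ^ 4 \<le> norm g * r"
    using f_le_Omega[of y M x] unfolding F_def r_def by linarith
  moreover have "M / 96 * r ^ 4 \<le> (M / 8 - L / 24) * r ^ 4"
    using M by (intro mult_right_mono) (auto simp: r_def)
  ultimately have "M / 96 * r ^ 4 \<le> norm g * r" by linarith
  then have "r ^ 3 \<le> 96 * norm g / M"
    using M by (cases "r = 0") (auto simp: r_def field_simps power4_eq_xxxx power3_eq_cube)
  then show ?thesis
    unfolding y_def[symmetric] r_def[symmetric] by (intro le_powr_third_if_cube_le) (simp add: r_def)
qed

lemma L_const_nonneg: "0 < M \<Longrightarrow> 0 \<le> L_const f M x g"
  unfolding L_const_def by (intro add_nonneg_nonneg mult_nonneg_nonneg trace_hessian_nonneg) auto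

lemma beta_const_nonneg: "0 < M \<Longrightarrow> 0 \<le> beta_const f M x g"
  unfolding beta_const_def by (intro add_nonneg_nonneg mult_nonneg_nonneg trace_hessian_nonneg) auto

text \<open>The residual is at most 3 \<open>Lc\<close> times the length of the last step. The
  contraction towards the next iterate, started from a \<open>rho\<close>-value of at most
  \<open>bc\<close>, makes that length decay geometrically.\<close>

lemma not_inner_failure:
  assumes g: "g \<in> subdifferential (ftilde f \<psi>) x" and M: "0 < M" "4 * L \<le> M"
  shows "\<not> inner_failure f \<psi> M x g k"
proof -
  define R where "R = (96 * norm g / M) powr (1 / 3)"
  define u z where "u = iter M x k" and "z = iter M x (Suc k)"
  define Lc bc where "Lc = L_const f M x g" and "bc = beta_const f M x g"
  have x: "x \<in> eff_dom \<psi>" using g by (simp add: subdifferential_ftilde)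
  have u: "norm (u - x) \<le> R" and z: "norm (z - x) \<le> R"
    unfolding u_def z_def R_def by (rule iter_radius[OF g M])+
  have Lc: "Lc = trace (hessian f x) + 3 * M / 2 * R\<^sup>2"
    and bc: "bc = 1 / 2 * trace (hessian f x) * R\<^sup>2 + M / 8 * R ^ 4"
    by (simp_all add: Lc_def bc_def R_def L_const_def beta_const_def powr_third_powers)
  have nonneg: "0 \<le> Lc" "0 \<le> bc"
    using M by (simp_all add: Lc_def bc_def L_const_nonneg beta_const_nonneg)
  have "gradient (Omega f M x) z + inner_gpsi f \<psi> M x k
      = (3 *\<^sub>R gradient (rho f M x) u - gradient (Omega f M x) u)
        - (3 *\<^sub>R gradient (rho f M x) z - gradient (Omega f M x) z)"
    unfolding inner_gpsi_def Let_def u_def[symmetric] z_def[symmetric] by (simp add: algebra_simps)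
  then have "inner_residual f \<psi> M x k \<le> 3 * Lc * norm (u - z)"
    unfolding inner_residual_def z_def[symmetric] Lc
    using surrogate_gradient_lipschitz[OF M(2) u z] by metis
  then have "inner_residual f \<psi> M x k ^ 4 \<le> (3 * Lc * norm (u - z)) ^ 4"
    by (intro power_mono) (auto simp: inner_residual_def)
  also have "\<dots> = 81 * Lc ^ 4 * norm (z - u) ^ 4"
    by (simp add: power_mult_distrib norm_minus_commute)
  also have "\<dots> \<le> 81 * Lc ^ 4 * (24 / M * ((5 / 6) ^ k * bc))"
  proof (rule mult_left_mono)
    have "rho f M x z \<le> bc"
    proof -
      have "(norm (z - x))\<^sup>2 \<le> R\<^sup>2" "norm (z - x) ^ 4 \<le> R ^ 4"
        using z by (intro power_mono; simp)+
      then have "trace (hessian f x) * ((z - x) \<bullet> (z - x)) \<le> trace (hessian f x) * R\<^sup>2"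
        "M / 8 * norm (z - x) ^ 4 \<le> M / 8 * R ^ 4"
        using M trace_hessian_nonneg[of x] by (auto intro!: mult_left_mono simp: dot_square_norm)
      then show ?thesis
        using D2_le_trace[of x "z - x"] unfolding rho_eq bc by linarith
    qed
    then have "(5 / 6) ^ k * rho f M x z \<le> (5 / 6) ^ k * bc"
      by (intro mult_left_mono) auto
    \<comment> \<open>Iterate k + 1 serves as the target of the contraction and as the end of the
      step.\<close>
    then have "M / 24 * norm (z - u) ^ 4 \<le> (5 / 6) ^ k * bc"
      using bregman_rho_ge[of M z u x] bregman_contraction[OF x M, of k "Suc k"] M
      unfolding u_def[symmetric] z_def[symmetric] by linarith
    then show "norm (z - u) ^ 4 \<le> 24 / M * ((5 / 6) ^ k * bc)"
      using M by (simp add: field_simps)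
  qed simp
  also have "\<dots> = 1944 * (Lc ^ 4 * bc) / (M * (6 / 5) ^ k)"
    using M by (simp add: field_simps power_divide)
  \<comment> \<open>81 * 24 = 1944 lies below 3^8 / 2.\<close>
  also have "\<dots> \<le> 6561 / 2 * (Lc ^ 4 * bc) / (M * (6 / 5) ^ k)"
    using M nonneg by (intro divide_right_mono mult_right_mono) auto
  also have "\<dots> = 3 ^ 8 * Lc ^ 4 * bc / (2 * M * (6 / 5) ^ k)"
    by simp
  finally show ?thesis
    unfolding inner_failure_def Lc_def bc_def by (simp add: not_less)
qed

text \<open>The residual \<open>e\<close> is below |G|/7 or M |h|^3 / 6, and the Taylor error is at
  most M |h|^3 / 24. Either way the total meets the error condition of
  \<open>decrease_from_step\<close>, and the subgradient inequality at \<open>z\<close> turns its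
  conclusion into a decrease of \<open>F\<close>.\<close>

lemma success_sufficient_decrease:
  assumes x: "x \<in> eff_dom \<psi>" and M: "0 < M" "4 * L \<le> M" and \<epsilon>: "0 < \<epsilon>"
    and success: "inner_success f \<psi> \<epsilon> M x k"
    and large: "norm (gradient f (iter M x (Suc k)) + inner_gpsi f \<psi> M x k) > \<epsilon>"
  shows "sufficient_decrease f \<psi> M x (iter M x (Suc k)) (inner_gpsi f \<psi> M x k)"
proof -
  define z where "z = iter M x (Suc k)"
  define G h e where "G = gradient f z + inner_gpsi f \<psi> M x k" and "h = z - x"
    and "e = gradient (Omega f M x) z + inner_gpsi f \<psi> M x k"
  have z: "z \<in> eff_dom \<psi>" unfolding z_def by (rule iter_in_dom[OF x M(1)])
  have e: "norm e \<le> norm G / 7 \<or> norm e \<le> M / 6 * norm h ^ 3"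
    using success large \<epsilon>
    unfolding inner_success_def inner_residual_def e_def G_def h_def z_def by linarith
  have "L / 6 * norm h ^ 3 \<le> M / 24 * norm h ^ 3"
    using M by (intro mult_right_mono) auto
  with gradient_f_Omega[of z M x]
  have "norm (G - e + (M / 2 * (norm h)\<^sup>2) *\<^sub>R h) \<le> M / 24 * norm h ^ 3"
    by (simp add: G_def e_def h_def)
  then have "norm (e + (G - e + (M / 2 * (norm h)\<^sup>2) *\<^sub>R h)) \<le> norm e + M / 24 * norm h ^ 3"
    by (intro norm_triangle_le) simp
  then have step: "norm (G + (M / 2 * (norm h)\<^sup>2) *\<^sub>R h) \<le> norm e + M / 24 * norm h ^ 3"
    by (simp add: algebra_simps)
  have "(norm e + M / 24 * norm h ^ 3)\<^sup>2 \<le> (norm G)\<^sup>2 / 4 + M\<^sup>2 * norm h ^ 6 / 8"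
  proof -
    define s where "s = M * norm h ^ 3"
    have s: "0 \<le> s" using M by (simp add: s_def)
    have "(norm e + s / 24)\<^sup>2 \<le> (norm G)\<^sup>2 / 4 + s\<^sup>2 / 8"
      using e
    proof
      assume "norm e \<le> norm G / 7"
      then have "(norm e + s / 24)\<^sup>2 \<le> (norm G / 7 + s / 24)\<^sup>2"
        using s by (intro power_mono) auto
      also have "\<dots> \<le> 2 * ((norm G / 7)\<^sup>2 + (s / 24)\<^sup>2)"
      proof -
        have "(a + b)\<^sup>2 \<le> 2 * (a\<^sup>2 + b\<^sup>2)" for a b :: real
          using sum_squares_bound[of a b] by (simp add: power2_sum)
        then show ?thesis .
      qed
      also have "\<dots> = 2 / 49 * (norm G)\<^sup>2 + s\<^sup>2 / 288"
        by (simp add: power_divide)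
      also have "\<dots> \<le> (norm G)\<^sup>2 / 4 + s\<^sup>2 / 8"
        using zero_le_power2[of "norm G"] zero_le_power2[of s] by linarith
      finally show ?thesis .
    next
      assume "norm e \<le> M / 6 * norm h ^ 3"
      then have "(norm e + s / 24)\<^sup>2 \<le> (s / 6 + s / 24)\<^sup>2"
        using s by (intro power_mono) (auto simp: s_def)
      also have "\<dots> \<le> (norm G)\<^sup>2 / 4 + s\<^sup>2 / 8"
        by (simp add: power2_eq_square)
      finally show ?thesis .
    qed
    then show ?thesis
      by (simp add: s_def power_mult_distrib flip: power_mult)
  qed
  from decrease_from_step[OF M(1) _ step this]
  have "1 / (6 * M powr (1 / 3)) * norm G powr (4 / 3) \<le> - (G \<bullet> h)"
    using large \<epsilon> by (force simp: G_def z_def)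
  moreover have "F z + G \<bullet> (x - z) \<le> F x"
    using output_subgradient[OF x M(1), of k] x
    unfolding subdifferential_ftilde G_def z_def by blast
  moreover have "G \<bullet> (x - z) = - (G \<bullet> h)" by (simp add: h_def algebra_simps)
  ultimately have "1 / (6 * M powr (1 / 3)) * norm G powr (4 / 3) \<le> F x - F z" by linarith
  then show ?thesis
    unfolding sufficient_decrease_def z_def[symmetric] G_def[symmetric] ftilde_eq[OF x] ftilde_eq[OF z]
    by simp
qed

end

section \<open>Complexity of the outer method\<close>

text \<open>Discrete analogue of integrating s' = - c s^(4/3): the power -1/3 grows at least
  linearly in the number of steps.\<close>

lemma inverse_cube_root_growth:
  fixes s s' c S :: real
  assumes s': "0 < s'" and c: "0 < c" and dec: "c * s' powr (4 / 3) \<le> s - s'" and S: "s \<le> S"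
  shows "s powr (- 1 / 3) + min (c / 24) (S powr (- 1 / 3)) \<le> s' powr (- 1 / 3)"
proof -
  define r w where "r = s' powr (1 / 3)" and "w = s powr (1 / 3)"
  have "0 < c * s' powr (4 / 3)" using s' c by simp
  then have s: "s' < s" "0 < s" using dec s' by linarith+
  have pos: "0 < r" "r < w" using s s' by (auto simp: r_def w_def powr_less_mono2)
  have pw: "s' = r ^ 3" "s = w ^ 3" "s' powr (4 / 3) = r ^ 4"
    using s s' powr_power[of s' "1 / 3" 3] powr_power[of s "1 / 3" 3] powr_power[of s' "1 / 3" 4]
    by (simp_all add: r_def w_def)
  have inv: "s' powr (- 1 / 3) = 1 / r" "s powr (- 1 / 3) = 1 / w"
    using s s' by (simp_all add: r_def w_def powr_minus_divide)
  \<comment> \<open>If the cube root shrinks by at most a factor 2, factoring w^3 - r^3 compares w -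
    r with r w. Otherwise 1/r is at least 2/w, a gain of 1/w, which is at least S^(-1/3).\<close>
  show ?thesis
  proof (cases "w \<le> 2 * r")
    case True
    have "c * r ^ 4 \<le> (w - r) * (w\<^sup>2 + w * r + r\<^sup>2)"
      using dec unfolding pw(3) unfolding pw(1,2) by (simp add: algebra_simps power3_eq_cube power2_eq_square)
    also have "\<dots> \<le> (w - r) * (12 * r\<^sup>2)"
    proof (rule mult_left_mono)
      have "w\<^sup>2 \<le> (2 * r)\<^sup>2" "w * r \<le> 2 * r * r"
        using True pos by (intro power_mono mult_right_mono; simp)+
      then have "w\<^sup>2 \<le> 4 * r\<^sup>2" "w * r \<le> 2 * r\<^sup>2"
        by (simp_all add: power2_eq_square)
      then show "w\<^sup>2 + w * r + r\<^sup>2 \<le> 12 * r\<^sup>2"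
        using zero_le_power2[of r] by linarith
    qed (use pos in simp)
    finally have "r\<^sup>2 * (c * r\<^sup>2) \<le> r\<^sup>2 * (12 * (w - r))"
      by (simp add: power4_eq_xxxx power2_eq_square algebra_simps)
    then have "c * r\<^sup>2 \<le> 12 * (w - r)"
      using pos by simp
    have "c / 24 * (r * w) \<le> c / 24 * (r * (2 * r))"
      using True pos c by (intro mult_left_mono) auto
    also have "\<dots> \<le> w - r"
      using \<open>c * r\<^sup>2 \<le> 12 * (w - r)\<close> by (simp add: power2_eq_square)
    finally have "c / 24 \<le> (w - r) / (r * w)"
      using pos by (simp add: pos_le_divide_eq)
    also have "\<dots> = 1 / r - 1 / w"
      using pos by (simp add: field_simps)
    finally show ?thesis unfolding inv by linarith
  next
    case False
    then have "2 / w \<le> 1 / r"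
      using pos by (simp add: field_simps)
    moreover have "S powr (- 1 / 3) \<le> s powr (- 1 / 3)"
      using s S by (intro powr_mono2') auto
    ultimately show ?thesis unfolding inv by (simp add: min_def)
  qed
qed

lemma first_i_bounds:
  assumes "0 < M0" "M0 \<le> M"
  shows "2 * M0 \<le> 2 ^ first_i M0 M * M" "first_i M0 M \<le> 1"
proof -
  have ex: "2 ^ 1 * M \<ge> 2 * M0" using assms by simp
  show "2 * M0 \<le> 2 ^ first_i M0 M * M"
    unfolding first_i_def by (rule LeastI[where P = "\<lambda>i. 2 * M0 \<le> 2 ^ i * M", OF ex])
  show "first_i M0 M \<le> 1"
    unfolding first_i_def by (rule Least_le[where P = "\<lambda>i. 2 * M0 \<le> 2 ^ i * M", OF ex])
qed

section \<open>Uniform constants for a run of the outer method\<close>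

locale tensor_method_problem = composite_problem f L \<psi>
  for f :: "real^'n \<Rightarrow> real" and L :: real and \<psi> :: "real^'n \<Rightarrow> ereal" +
  fixes xstar x0 g0 :: "real^'n" and R0 M0 :: real
  assumes minimizer: "\<And>x. ftilde f \<psi> xstar \<le> ftilde f \<psi> x"
    and x0_dom: "x0 \<in> eff_dom \<psi>"
    and g0_subgradient: "g0 \<in> subdifferential (ftilde f \<psi>) x0"
    and M0_pos: "M0 > 0"
    and R0_pos: "R0 > 0"
    and level_set: "\<And>x. ftilde f \<psi> x \<le> ftilde f \<psi> x0 \<Longrightarrow> norm (x - xstar) \<le> R0"
begin

lemma xstar_dom: "xstar \<in> eff_dom \<psi>"
  using minimizer[of x0] x0_dom by (metis ftilde_eq ftilde_infinite infinity_ereal_def ereal_infty_less_eq(1) PInfty_neq_ereal(1))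

lemma F_min: "x \<in> eff_dom \<psi> \<Longrightarrow> F xstar \<le> F x"
  using minimizer[of x] by (simp add: ftilde_eq xstar_dom)

lemma F_level_set: "x \<in> eff_dom \<psi> \<Longrightarrow> F x \<le> F x0 \<Longrightarrow> norm (x - xstar) \<le> R0"
  using level_set[of x] by (simp add: ftilde_eq x0_dom)

text \<open>The first inner call uses \<open>2 * M0\<close>, and only parameters below
  \<open>4 * L\<close> are ever rejected and doubled.\<close>

definition M_max :: real where
  "M_max = max (2 * M0) (8 * L)"

text \<open>Covers the initial subgradient and those after accepted steps, whose power 4/3 is paid
  for by the total available decrease.\<close>

definition g_max :: real where
  "g_max = max (norm g0) ((6 * M_max powr (1 / 3) * (F x0 - F xstar)) powr (3 / 4))"

lemma M_max_pos: "0 < M_max"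
  using M0_pos by (simp add: M_max_def)

text \<open>Compactness: the ball contains the initial level set, and the second derivative is
  continuous since it is differentiable.\<close>

lemma trace_hessian_bound:
  obtains T where "0 \<le> T" "\<And>x. norm (x - xstar) \<le> R0 \<Longrightarrow> trace (hessian f x) \<le> T"
proof -
  have "continuous_on (cball xstar R0) (\<lambda>x. trace (hessian f x))"
    unfolding trace_hessian
    by (intro continuous_on_sum continuous_at_imp_continuous_on ballI
        has_derivative_continuous[OF D2_apply_deriv])
  then obtain y where "y \<in> cball xstar R0" "\<And>x. x \<in> cball xstar R0 \<Longrightarrow> trace (hessian f x) \<le> trace (hessian f y)"
    using continuous_attains_sup[of "cball xstar R0" "\<lambda>x. trace (hessian f x)"] R0_pos by auto
  then show ?thesis
    using that[of "trace (hessian f y)"] by (simp add: trace_hessian_nonneg dist_norm norm_minus_commute)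
qed

lemma failure_threshold_bound:
  obtains C where "0 < C"
    "\<And>x (g :: real^'n) M. norm (x - xstar) \<le> R0 \<Longrightarrow> norm g \<le> g_max \<Longrightarrow> 2 * M0 \<le> M \<Longrightarrow> M \<le> M_max \<Longrightarrow>
      3 ^ 8 * L_const f M x g ^ 4 * beta_const f M x g / (2 * M) \<le> C"
proof -
  obtain T where T: "0 \<le> T" "\<And>x. norm (x - xstar) \<le> R0 \<Longrightarrow> trace (hessian f x) \<le> T"
    by (rule trace_hessian_bound) blast
  define a where "a = 96 * g_max / (2 * M0)"
  define Lb bb where "Lb = T + 3 * M_max / 2 * a powr (2 / 3)"
    and "bb = 1 / 2 * T * a powr (2 / 3) + M_max / 8 * a powr (4 / 3)"
  have nonneg: "0 \<le> Lb" "0 \<le> bb"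
    using T M_max_pos by (auto simp: Lb_def bb_def)
  show ?thesis
  proof (rule that)
    \<comment> \<open>The summand 1 makes the constant strictly positive; its logarithm is taken
      later.\<close>
    show "0 < 3 ^ 8 * Lb ^ 4 * bb / (2 * (2 * M0)) + 1"
      using nonneg M0_pos by (intro add_nonneg_pos divide_nonneg_pos mult_nonneg_nonneg) auto
    fix x g :: "real^'n" and M assume asm: "norm (x - xstar) \<le> R0" "norm g \<le> g_max" "2 * M0 \<le> M" "M \<le> M_max"
    then have M: "0 < M" using M0_pos by linarith
    have "96 * norm g / M \<le> a"
      unfolding a_def using asm M0_pos order_trans[OF norm_ge_zero asm(2)] by (intro frac_le) auto
    moreover have "0 \<le> 96 * norm g / M" using M by simp
    ultimately have p: "(96 * norm g / M) powr (2 / 3) \<le> a powr (2 / 3)"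
      "(96 * norm g / M) powr (4 / 3) \<le> a powr (4 / 3)"
      by (auto intro!: powr_mono2)
    have "L_const f M x g \<le> Lb"
      unfolding L_const_def Lb_def using asm M T p by (intro add_mono mult_mono) auto
    then have "L_const f M x g ^ 4 \<le> Lb ^ 4"
      by (rule power_mono[OF _ L_const_nonneg[OF M]])
    moreover have "beta_const f M x g \<le> bb"
      unfolding beta_const_def bb_def using asm M T p trace_hessian_nonneg[of x]
      by (intro add_mono mult_mono) auto
    ultimately have "3 ^ 8 * L_const f M x g ^ 4 * beta_const f M x g / (2 * M) \<le> 3 ^ 8 * Lb ^ 4 * bb / (2 * (2 * M0))"
      using asm M M0_pos nonneg beta_const_nonneg[OF M, of x g] L_const_nonneg[OF M, of x g]
      by (intro frac_le mult_mono) auto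
    then show "3 ^ 8 * L_const f M x g ^ 4 * beta_const f M x g / (2 * M)
        \<le> 3 ^ 8 * Lb ^ 4 * bb / (2 * (2 * M0)) + 1" by linarith
  qed
qed

text \<open>If both tests were negative at index \<open>n\<close>, the residual would exceed
  \<epsilon>/7 while the decaying failure threshold is already below it. This covers parameters
  below \<open>4 * L\<close> as well.\<close>

lemma alg1_terminates:
  assumes \<epsilon>: "0 < \<epsilon>" and M: "0 < M"
    and C: "3 ^ 8 * L_const f M x g ^ 4 * beta_const f M x g / (2 * M) \<le> C"
    and n: "C \<le> (\<epsilon> / 7) ^ 4 * (6 / 5) ^ n"
  obtains k \<alpha> where "alg1 f \<psi> \<epsilon> x g M (iter M x (Suc k)) \<alpha> (inner_gpsi f \<psi> M x k) (Suc k)" "k \<le> n"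
    "inner_success f \<psi> \<epsilon> M x k \<and> \<alpha> = 0 \<or> inner_failure f \<psi> M x g k \<and> \<alpha> = 1"
proof -
  let ?stop = "\<lambda>k. inner_success f \<psi> \<epsilon> M x k \<or> inner_failure f \<psi> M x g k"
  have stop: "?stop n"
  proof (rule ccontr)
    assume no: "\<not> ?stop n"
    then have "(\<epsilon> / 7) ^ 4 < inner_residual f \<psi> M x n ^ 4"
      using \<epsilon> unfolding inner_success_def by (intro power_strict_mono) auto
    also have "\<dots> \<le> 3 ^ 8 * L_const f M x g ^ 4 * beta_const f M x g / (2 * M * (6 / 5) ^ n)"
      using no unfolding inner_failure_def by simp
    also have "\<dots> = 3 ^ 8 * L_const f M x g ^ 4 * beta_const f M x g / (2 * M) / (6 / 5) ^ n"
      by simp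
    also have "\<dots> \<le> (\<epsilon> / 7) ^ 4"
      by (subst pos_divide_le_eq) (simp, rule order_trans[OF C n])
    finally show False by simp
  qed
  define k where "k = (LEAST k. ?stop k)"
  have k: "?stop k" "k \<le> n" "\<And>j. j < k \<Longrightarrow> \<not> ?stop j"
    unfolding k_def using LeastI[of ?stop, OF stop] Least_le[of ?stop, OF stop] not_less_Least[of _ ?stop]
    by blast+
  show ?thesis
  proof (cases "inner_success f \<psi> \<epsilon> M x k")
    case True
    then show ?thesis
      using k by (intro that[of k 0]) (auto simp: alg1_def)
  next
    case False
    then show ?thesis
      using k by (intro that[of k 1]) (auto simp: alg1_def)
  qed
qed

section \<open>Potential and invariant of a run\<close>

text \<open>Counts inner calls: a rejection doubles the parameter, adding 1; an accepted step adds 2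
  and at most halves the parameter, a net gain of at least 1.\<close>

definition run_potential :: "nat \<Rightarrow> real \<Rightarrow> real" where
  "run_potential t M = 2 * real t + log 2 (M / (2 * M0))"

text \<open>The decrease guaranteed per accepted step, with the subgradient norm bounded below by
  the shifted gap over \<open>2 * R0\<close>.\<close>

definition decrease_const :: real where
  "decrease_const = 1 / (6 * M_max powr (1 / 3)) / (2 * R0) powr (4 / 3)"

definition growth_const :: real where
  "growth_const = min (decrease_const / 24) ((F x0 - F xstar + R0) powr (- 1 / 3))"

text \<open>The shift by \<open>min \<epsilon> 1 * R0\<close> lets one potential cover both phases of the method: the
  decay of the gap and, once the gap is below \<open>\<epsilon> * R0\<close>, the decrease by a fixed amount.\<close>

definition shifted_gap :: "real \<Rightarrow> real^'n \<Rightarrow> real" where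
  "shifted_gap \<epsilon> x = F x - F xstar + min \<epsilon> 1 * R0"

definition inner_cap :: "real \<Rightarrow> nat \<Rightarrow> bool" where
  "inner_cap \<epsilon> K \<longleftrightarrow> (\<forall>x g M. norm (x - xstar) \<le> R0 \<and> norm g \<le> g_max \<and> 2 * M0 \<le> M \<and> M \<le> M_max \<longrightarrow>
     (\<exists>k \<alpha>. alg1 f \<psi> \<epsilon> x g M (iter M x (Suc k)) \<alpha> (inner_gpsi f \<psi> M x k) (Suc k) \<and> Suc k \<le> K \<and>
       (inner_success f \<psi> \<epsilon> M x k \<and> \<alpha> = 0 \<or> inner_failure f \<psi> M x g k \<and> \<alpha> = 1)))"

text \<open>The bounds on \<open>F x\<close>, \<open>g\<close> and the parameter make
  \<open>inner_cap\<close> applicable to the next call. The last two conjuncts bound the cost so far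
  by the number of calls, and the number of accepted steps by the shifted gap.\<close>

definition run_state ::
  "real \<Rightarrow> nat \<Rightarrow> nat \<Rightarrow> real^'n \<Rightarrow> real^'n \<Rightarrow> real \<Rightarrow> nat \<Rightarrow> nat \<Rightarrow> bool" where
  "run_state \<epsilon> K t x g M i N \<longleftrightarrow>
     alg2_state f \<psi> M0 \<epsilon> x0 g0 t x g M i N \<and> g \<in> subdifferential (ftilde f \<psi>) x \<and>
     F x \<le> F x0 \<and> norm g \<le> g_max \<and> 2 * M0 \<le> 2 ^ i * M \<and> 2 ^ i * M \<le> M_max \<and>
     real N \<le> real K * run_potential t (2 ^ i * M) \<and>
     growth_const * real t \<le> shifted_gap \<epsilon> x powr (- 1 / 3)"

lemma decrease_const_pos: "0 < decrease_const"
  using M_max_pos R0_pos by (simp add: decrease_const_def)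

lemma growth_const_pos: "0 < growth_const"
proof -
  have "0 < F x0 - F xstar + R0"
    using F_min[OF x0_dom] R0_pos by linarith
  then show ?thesis
    using decrease_const_pos by (simp add: growth_const_def)
qed

lemma shifted_gap_ge: "0 < \<epsilon> \<Longrightarrow> x \<in> eff_dom \<psi> \<Longrightarrow> min \<epsilon> 1 * R0 \<le> shifted_gap \<epsilon> x"
  using F_min[of x] by (simp add: shifted_gap_def)

lemma run_state_init:
  assumes "0 < \<epsilon>"
  shows "run_state \<epsilon> K 0 x0 g0 M0 (first_i M0 M0) 0"
proof -
  have "2 ^ first_i M0 M0 \<le> (2::real) ^ 1"
    using first_i_bounds(2)[OF M0_pos order_refl] by (intro power_increasing) auto
  then have "2 ^ first_i M0 M0 * M0 \<le> 2 ^ 1 * M0"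
    using M0_pos by (intro mult_right_mono) auto
  \<comment> \<open>The first parameter is exactly \<open>2 * M0\<close>, where the potential is
    0.\<close>
  with first_i_bounds(1)[OF M0_pos order_refl] have eq: "2 ^ first_i M0 M0 * M0 = 2 * M0" by simp
  show ?thesis
    using M0_pos unfolding run_state_def eq
    by (auto simp: alg2_state.init g0_subgradient g_max_def M_max_def run_potential_def)
qed

text \<open>The shifted gap never falls below \<open>min \<epsilon> 1 * R0\<close>, which limits the
  accepted steps; \<open>M_max\<close> limits the logarithm.\<close>

lemma run_state_bound:
  assumes "0 < \<epsilon>" and st: "run_state \<epsilon> K t x g M i N"
  shows "run_potential t (2 ^ i * M)
    \<le> 2 * ((min \<epsilon> 1 * R0) powr (- 1 / 3) / growth_const) + log 2 (M_max / (2 * M0))"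
proof -
  have Mi: "2 * M0 \<le> 2 ^ i * M" "2 ^ i * M \<le> M_max" and x: "x \<in> eff_dom \<psi>"
    using st unfolding run_state_def by (auto simp: subdifferential_ftilde)
  have "growth_const * real t \<le> shifted_gap \<epsilon> x powr (- 1 / 3)"
    using st unfolding run_state_def by blast
  also have "\<dots> \<le> (min \<epsilon> 1 * R0) powr (- 1 / 3)"
    using assms(1) R0_pos shifted_gap_ge[OF assms(1) x] by (intro powr_mono2') auto
  finally have "real t \<le> (min \<epsilon> 1 * R0) powr (- 1 / 3) / growth_const"
    using growth_const_pos by (simp add: pos_le_divide_eq mult.commute)
  moreover have "log 2 (2 ^ i * M / (2 * M0)) \<le> log 2 (M_max / (2 * M0))"
    using Mi M0_pos by (subst log_le_cancel_iff) (auto simp: divide_right_mono)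
  ultimately show ?thesis by (simp add: run_potential_def)
qed

text \<open>One inner call either ends the run or raises the potential by at least 1, at a cost of
  at most \<open>K\<close> iterations.\<close>

lemma run_step:
  assumes \<epsilon>: "0 < \<epsilon>" and st: "run_state \<epsilon> K t x g M i N"
    and cap: "inner_cap \<epsilon> K"
  shows "(\<exists>xb gb Nb. alg2_generates f \<psi> M0 \<epsilon> x0 g0 xb gb Nb \<and>
      gb \<in> subdifferential (ftilde f \<psi>) xb \<and> norm gb \<le> \<epsilon> \<and>
      real Nb \<le> real K * (run_potential t (2 ^ i * M) + 1)) \<or>
    (\<exists>t' x' g' M' i' N'. run_state \<epsilon> K t' x' g' M' i' N' \<and>
      run_potential t (2 ^ i * M) + 1 \<le> run_potential t' (2 ^ i' * M'))"
proof -
  define m where "m = 2 ^ i * M"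
  have state: "alg2_state f \<psi> M0 \<epsilon> x0 g0 t x g M i N" and g: "g \<in> subdifferential (ftilde f \<psi>) x"
    and Fx: "F x \<le> F x0" and g_le: "norm g \<le> g_max" and m: "2 * M0 \<le> m" "m \<le> M_max"
    and N: "real N \<le> real K * run_potential t m"
    and growth: "growth_const * real t \<le> shifted_gap \<epsilon> x powr (- 1 / 3)"
    using st unfolding run_state_def m_def by blast+
  have m0: "0 < m" using m M0_pos by linarith
  have x: "x \<in> eff_dom \<psi>" using g by (simp add: subdifferential_ftilde)
  obtain k \<alpha> where call: "alg1 f \<psi> \<epsilon> x g m (iter m x (Suc k)) \<alpha> (inner_gpsi f \<psi> m x k) (Suc k)"
    and k: "Suc k \<le> K"
    and outcome: "inner_success f \<psi> \<epsilon> m x k \<and> \<alpha> = 0 \<or> inner_failure f \<psi> m x g k \<and> \<alpha> = 1"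
    using cap F_level_set[OF x Fx] g_le m unfolding inner_cap_def by blast
  define z gp where "z = iter m x (Suc k)" and "gp = inner_gpsi f \<psi> m x k"
  define G where "G = gradient f z + gp"
  have z: "z \<in> eff_dom \<psi>" unfolding z_def by (rule iter_in_dom[OF x m0])
  have G: "G \<in> subdifferential (ftilde f \<psi>) z"
    unfolding G_def z_def gp_def by (rule output_subgradient[OF x m0])
  have cost: "real (N + Suc k) \<le> real K * (run_potential t m + 1)"
    using N k by (simp add: distrib_left)
  note call = call[folded z_def gp_def, unfolded m_def]
  \<comment> \<open>Shared by both kinds of rejection; each of them forces \<open>m < 4 * L\<close>,
    so doubling stays below \<open>M_max\<close>.\<close>
  have reject: ?thesis
    if next_state: "alg2_state f \<psi> M0 \<epsilon> x0 g0 t x g M (Suc i) (N + Suc k)" and small: "m < 4 * L"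
  proof -
    have P: "run_potential t (2 ^ Suc i * M) = run_potential t m + 1"
    proof -
      have e: "2 ^ Suc i * M / (2 * M0) = 2 * (m / (2 * M0))"
        by (simp add: m_def)
      have l: "log 2 (2 * (m / (2 * M0))) = log 2 2 + log 2 (m / (2 * M0))"
        using m0 M0_pos by (subst log_mult) auto
      show ?thesis unfolding run_potential_def e l by simp
    qed
    have "run_state \<epsilon> K t x g M (Suc i) (N + Suc k)"
      unfolding run_state_def P
    proof (intro conjI next_state g Fx g_le cost growth)
      have "2 ^ Suc i * M = 2 * m" "8 * L \<le> M_max" by (simp_all add: m_def M_max_def)
      then show "2 * M0 \<le> 2 ^ Suc i * M" "2 ^ Suc i * M \<le> M_max"
        using m m0 small by linarith+
    qed
    then show ?thesis
      using P unfolding m_def by (metis order_refl)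
  qed
  consider (stop) "\<alpha> = 0" "norm G \<le> \<epsilon>"
    | (accept) "\<alpha> = 0" "norm G > \<epsilon>" "sufficient_decrease f \<psi> m x z gp"
    | (no_decrease) "\<alpha> = 0" "norm G > \<epsilon>" "\<not> sufficient_decrease f \<psi> m x z gp" "inner_success f \<psi> \<epsilon> m x k"
    | (flagged) "\<alpha> = 1" "inner_failure f \<psi> m x g k"
    using outcome by linarith
  then show ?thesis
  proof cases
    case flagged
    moreover have "m < 4 * L"
      using not_inner_failure[OF g m0] flagged by force
    ultimately show ?thesis
      using reject alg2_state.flagged[OF state, of z gp "Suc k"] call by blast
  next
    case no_decrease
    moreover have "m < 4 * L"
      using success_sufficient_decrease[OF x m0 _ \<epsilon> no_decrease(4)] no_decrease(2,3)
      unfolding G_def z_def gp_def by force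
    ultimately show ?thesis
      using reject alg2_state.no_decrease[OF state, of z gp "Suc k"] call unfolding G_def m_def by blast
  next
    case stop
    then have "alg2_generates f \<psi> M0 \<epsilon> x0 g0 z G (N + Suc k)"
      using alg2_generates.stop[OF state, of z gp "Suc k"] call unfolding G_def by blast
    then show ?thesis
      using stop G cost unfolding m_def by blast
  next
    case accept
    define M' where "M' = m / 2"
    define i' where "i' = first_i M0 M'"
    \<comment> \<open>Hence \<open>i'\<close> is 0 or 1, and the next parameter lies between
      \<open>m / 2\<close> and \<open>m\<close>.\<close>
    have "M0 \<le> M'" using m by (simp add: M'_def)
    note i'_bounds = first_i_bounds[OF M0_pos this, folded i'_def]
    have "2 ^ i' \<le> (2::real) ^ 1" "1 \<le> (2::real) ^ i'"
      using i'_bounds(2) by (intro power_increasing) auto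
    then have "2 ^ i' * M' \<le> 2 ^ 1 * M'" "1 * M' \<le> 2 ^ i' * M'"
      using m0 by (intro mult_right_mono; simp add: M'_def)+
    then have m': "2 * M0 \<le> 2 ^ i' * M'" "2 ^ i' * M' \<le> m" "m / 2 \<le> 2 ^ i' * M'"
      using i'_bounds(1) by (simp_all add: M'_def)
    have P: "run_potential t m + 1 \<le> run_potential (Suc t) (2 ^ i' * M')"
    proof -
      have "log 2 q - 1 = log 2 (q / 2)" if "0 < q" for q :: real
        using that by (simp add: log_divide)
      from this[of "m / (2 * M0)"] have "log 2 (m / (2 * M0)) - 1 = log 2 (m / (2 * M0) / 2)"
        using m0 M0_pos by simp
      also have "\<dots> \<le> log 2 (2 ^ i' * M' / (2 * M0))"
        using m0 m' M0_pos by (subst log_le_cancel_iff) (auto simp: field_simps)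
      finally show ?thesis by (simp add: run_potential_def)
    qed
    have dec: "1 / (6 * m powr (1 / 3)) * norm G powr (4 / 3) \<le> F x - F z"
      using accept(3) unfolding sufficient_decrease_def G_def ftilde_eq[OF x] ftilde_eq[OF z] by simp
    have "1 / (6 * M_max powr (1 / 3)) \<le> 1 / (6 * m powr (1 / 3))"
      using m m0 by (intro divide_left_mono mult_left_mono powr_mono2) auto
    then have dec': "1 / (6 * M_max powr (1 / 3)) * norm G powr (4 / 3) \<le> F x - F z"
      using dec by (meson mult_right_mono order_trans powr_ge_zero)
    have "0 \<le> 1 / (6 * M_max powr (1 / 3)) * norm G powr (4 / 3)" by simp
    with dec' have Fz: "F z \<le> F x" by linarith
    have G_le: "norm G \<le> g_max"
    proof -
      have "norm G powr (4 / 3) \<le> 6 * M_max powr (1 / 3) * (F x0 - F xstar)"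
      proof -
        have "norm G powr (4 / 3) \<le> 6 * M_max powr (1 / 3) * (F x - F z)"
          using dec' M_max_pos by (simp add: field_simps)
        also have "\<dots> \<le> 6 * M_max powr (1 / 3) * (F x0 - F xstar)"
          using Fx F_min[OF z] by (intro mult_left_mono) auto
        finally show ?thesis .
      qed
      then have "(norm G powr (4 / 3)) powr (3 / 4) \<le> (6 * M_max powr (1 / 3) * (F x0 - F xstar)) powr (3 / 4)"
        by (intro powr_mono2) auto
      then show ?thesis by (simp add: powr_powr g_max_def)
    qed
    have s_pos: "0 < shifted_gap \<epsilon> z"
      using shifted_gap_ge[OF \<epsilon> z] \<epsilon> R0_pos by (smt (verit) mult_pos_pos)
    have "decrease_const * shifted_gap \<epsilon> z powr (4 / 3) \<le> shifted_gap \<epsilon> x - shifted_gap \<epsilon> z"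
    proof -
      have "F z + G \<bullet> (xstar - z) \<le> F xstar"
        using G xstar_dom by (simp add: subdifferential_ftilde)
      moreover have "- (G \<bullet> (xstar - z)) \<le> norm G * R0"
      proof -
        have "- (G \<bullet> (xstar - z)) \<le> norm G * norm (xstar - z)"
          using Cauchy_Schwarz_ineq2[of G "xstar - z"] by linarith
        also have "\<dots> \<le> norm G * R0"
          using F_level_set[OF z] Fz Fx by (intro mult_left_mono) (auto simp: norm_minus_commute)
        finally show ?thesis .
      qed
      moreover have "min \<epsilon> 1 * R0 \<le> norm G * R0"
        using accept(2) R0_pos by (intro mult_right_mono) auto
      \<comment> \<open>Convexity bounds the gap by \<open>norm G * R0\<close>, and
        \<open>norm G > \<epsilon>\<close> bounds the shift by the same quantity.\<close>
      ultimately have "shifted_gap \<epsilon> z \<le> norm G * (2 * R0)"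
        unfolding shifted_gap_def by linarith
      then have "shifted_gap \<epsilon> z powr (4 / 3) \<le> (norm G * (2 * R0)) powr (4 / 3)"
        using s_pos by (intro powr_mono2) auto
      also have "\<dots> = norm G powr (4 / 3) * (2 * R0) powr (4 / 3)"
        using R0_pos by (simp add: powr_mult)
      finally have "decrease_const * shifted_gap \<epsilon> z powr (4 / 3)
          \<le> decrease_const * (norm G powr (4 / 3) * (2 * R0) powr (4 / 3))"
        using decrease_const_pos by (intro mult_left_mono) auto
      also have "\<dots> = 1 / (6 * M_max powr (1 / 3)) * norm G powr (4 / 3)"
        using R0_pos by (simp add: decrease_const_def)
      finally show ?thesis
        using dec' by (simp add: shifted_gap_def)
    qed
    moreover have "shifted_gap \<epsilon> x \<le> F x0 - F xstar + R0"
    proof -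
      have "min \<epsilon> 1 * R0 \<le> 1 * R0"
        using R0_pos by (intro mult_right_mono) auto
      then show ?thesis using Fx unfolding shifted_gap_def by linarith
    qed
    ultimately have "shifted_gap \<epsilon> x powr (- 1 / 3) + growth_const \<le> shifted_gap \<epsilon> z powr (- 1 / 3)"
      unfolding growth_const_def by (rule inverse_cube_root_growth[OF s_pos decrease_const_pos])
    with growth have "growth_const * real (Suc t) \<le> shifted_gap \<epsilon> z powr (- 1 / 3)"
      by (simp add: distrib_left)
    moreover have "alg2_state f \<psi> M0 \<epsilon> x0 g0 (Suc t) z G M' i' (N + Suc k)"
      using alg2_state.accept[OF state, of z gp "Suc k"] call accept
      unfolding G_def i'_def M'_def m_def by blast
    moreover have "real (N + Suc k) \<le> real K * run_potential (Suc t) (2 ^ i' * M')"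
      using cost mult_left_mono[OF P, of "real K"] by linarith
    ultimately have "run_state \<epsilon> K (Suc t) z G M' i' (N + Suc k)"
      unfolding run_state_def using G G_le Fz Fx m m' by auto
    then show ?thesis
      using P unfolding m_def by blast
  qed
qed

section \<open>Counting inner iterations\<close>

text \<open>The largest potential allowed by \<open>run_state_bound\<close>, plus one for the final
  call.\<close>

definition calls_bound :: "real \<Rightarrow> real" where
  "calls_bound \<epsilon> = 2 * ((min \<epsilon> 1 * R0) powr (- 1 / 3) / growth_const) + log 2 (M_max / (2 * M0)) + 1"

lemma log_M_max_nonneg: "0 \<le> log 2 (M_max / (2 * M0))"
  using M0_pos by (simp add: M_max_def le_max_iff_disj)

lemma calls_bound_nonneg: "0 \<le> calls_bound \<epsilon>"
  using growth_const_pos log_M_max_nonneg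
  unfolding calls_bound_def by (intro add_nonneg_nonneg mult_nonneg_nonneg divide_nonneg_pos) auto

text \<open>If no such output appeared, \<open>run_step\<close> could be repeated forever and the
  potential would outgrow its bound.\<close>

lemma generates_within:
  assumes \<epsilon>: "0 < \<epsilon>"
    and cap: "inner_cap \<epsilon> K"
  shows "\<exists>xb gb Nb. alg2_generates f \<psi> M0 \<epsilon> x0 g0 xb gb Nb \<and>
    gb \<in> subdifferential (ftilde f \<psi>) xb \<and> norm gb \<le> \<epsilon> \<and> real Nb \<le> real K * calls_bound \<epsilon>"
proof (rule ccontr)
  assume none: "\<not> ?thesis"
  have "\<exists>t x g M i N. run_state \<epsilon> K t x g M i N \<and> real n \<le> run_potential t (2 ^ i * M)" for n
  proof (induction n)
    case 0
    have "0 \<le> run_potential 0 (2 ^ first_i M0 M0 * M0)"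
      using first_i_bounds(1)[OF M0_pos order_refl] M0_pos by (simp add: run_potential_def)
    with run_state_init[OF \<epsilon>, of K] show ?case
      by (metis of_nat_0)
  next
    case (Suc n)
    then obtain t x g M i N where st: "run_state \<epsilon> K t x g M i N"
      and n: "real n \<le> run_potential t (2 ^ i * M)" by blast
    have "run_potential t (2 ^ i * M) + 1 \<le> calls_bound \<epsilon>"
      using run_state_bound[OF \<epsilon> st] by (simp add: calls_bound_def)
    then have le: "real K * (run_potential t (2 ^ i * M) + 1) \<le> real K * calls_bound \<epsilon>"
      by (intro mult_left_mono) auto
    consider xb gb Nb where "alg2_generates f \<psi> M0 \<epsilon> x0 g0 xb gb Nb"
        "gb \<in> subdifferential (ftilde f \<psi>) xb" "norm gb \<le> \<epsilon>"
        "real Nb \<le> real K * (run_potential t (2 ^ i * M) + 1)"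
      | t' x' g' M' i' N' where "run_state \<epsilon> K t' x' g' M' i' N'"
        "run_potential t (2 ^ i * M) + 1 \<le> run_potential t' (2 ^ i' * M')"
      using run_step[OF \<epsilon> st cap] by metis
    then show ?case
    proof cases
      case 1
      with none le show ?thesis by (meson order_trans)
    next
      case 2
      then have "real (Suc n) \<le> run_potential t' (2 ^ i' * M')" using n by simp
      with 2(1) show ?thesis by blast
    qed
  qed
  moreover obtain n where "calls_bound \<epsilon> < real n"
    using reals_Archimedean2 by blast
  ultimately show False
    using run_state_bound[OF \<epsilon>] unfolding calls_bound_def by (smt (verit, best))
qed

lemma complexity_bigo:
  fixes K :: "real \<Rightarrow> nat"
  assumes K: "\<And>\<epsilon>. 0 < \<epsilon> \<Longrightarrow> real (K \<epsilon>) \<le> a + b * \<bar>log (6 / 5) \<epsilon>\<bar>" and ab: "0 \<le> a" "0 \<le> b"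
  shows "(\<lambda>\<epsilon>. real (nat \<lfloor>real (K \<epsilon>) * calls_bound \<epsilon>\<rfloor>))
    \<in> O[at_right 0](\<lambda>\<epsilon>. \<bar>log (6 / 5) \<epsilon>\<bar> * \<epsilon> powr (- 1 / 3))"
proof (rule bigoI)
  define A D where "A = 2 * R0 powr (- 1 / 3) / growth_const"
    and "D = log 2 (M_max / (2 * M0)) + 1"
  have AD: "0 \<le> A" "0 \<le> D"
    using growth_const_pos log_M_max_nonneg by (simp_all add: A_def D_def)
  show "\<forall>\<^sub>F \<epsilon> in at_right 0. norm (real (nat \<lfloor>real (K \<epsilon>) * calls_bound \<epsilon>\<rfloor>))
      \<le> (a + b) * (A + D) * norm (\<bar>log (6 / 5) \<epsilon>\<bar> * \<epsilon> powr (- 1 / 3))"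
  \<comment> \<open>Below 5/6 both |log \<epsilon>| and \<epsilon>^(-1/3) are at least 1 and absorb
    the additive constants, and \<open>min \<epsilon> 1\<close> is \<epsilon>.\<close>
  proof (rule eventually_at_rightI[of _ "5 / 6"])
    fix \<epsilon> :: real assume "\<epsilon> \<in> {0<..<5 / 6}"
    then have \<epsilon>: "0 < \<epsilon>" "\<epsilon> < 5 / 6" by auto
    have "log (6 / 5) \<epsilon> \<le> log (6 / 5) (inverse (6 / 5))"
      using \<epsilon> by (subst log_le_cancel_iff) auto
    also have "\<dots> = - 1"
      by (subst log_inverse) auto
    finally have l: "1 \<le> \<bar>log (6 / 5) \<epsilon>\<bar>" by simp
    have p: "1 \<le> \<epsilon> powr (- 1 / 3)"
      using powr_mono2'[of "- 1 / 3" \<epsilon> 1] \<epsilon> by simp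
    have "real (K \<epsilon>) \<le> (a + b) * \<bar>log (6 / 5) \<epsilon>\<bar>"
      using K[OF \<epsilon>(1)] mult_left_mono[OF l ab(1)] by (simp add: distrib_right)
    moreover have "calls_bound \<epsilon> \<le> (A + D) * \<epsilon> powr (- 1 / 3)"
    proof -
      have "calls_bound \<epsilon> = A * \<epsilon> powr (- 1 / 3) + D"
        using \<epsilon> R0_pos by (simp add: calls_bound_def A_def D_def min_def powr_mult)
      then show ?thesis
        using mult_left_mono[OF p AD(2)] by (simp add: distrib_right)
    qed
    ultimately have "real (K \<epsilon>) * calls_bound \<epsilon>
        \<le> ((a + b) * \<bar>log (6 / 5) \<epsilon>\<bar>) * ((A + D) * \<epsilon> powr (- 1 / 3))"
      using ab by (intro mult_mono calls_bound_nonneg mult_nonneg_nonneg) auto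
    moreover have "real (nat \<lfloor>real (K \<epsilon>) * calls_bound \<epsilon>\<rfloor>) \<le> real (K \<epsilon>) * calls_bound \<epsilon>"
      using calls_bound_nonneg by (intro of_nat_floor) simp
    ultimately show "norm (real (nat \<lfloor>real (K \<epsilon>) * calls_bound \<epsilon>\<rfloor>))
        \<le> (a + b) * (A + D) * norm (\<bar>log (6 / 5) \<epsilon>\<bar> * \<epsilon> powr (- 1 / 3))"
      by (simp add: mult_ac)
  qed simp
qed

lemma stationarity_complexity:
  "\<exists>bound :: real \<Rightarrow> nat.
    (\<lambda>\<epsilon>. real (bound \<epsilon>)) \<in> O[at_right 0](\<lambda>\<epsilon>. \<bar>log (6 / 5) \<epsilon>\<bar> * \<epsilon> powr (- 1 / 3)) \<and>
    (\<forall>\<epsilon>>0. \<exists>xbar gbar N.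
        alg2_generates f \<psi> M0 \<epsilon> x0 g0 xbar gbar N \<and> N \<le> bound \<epsilon> \<and>
        gbar \<in> subdifferential (ftilde f \<psi>) xbar \<and> norm gbar \<le> \<epsilon>)"
proof -
  obtain C where C: "0 < C"
    and thr: "\<And>x (g :: real^'n) M. norm (x - xstar) \<le> R0 \<Longrightarrow> norm g \<le> g_max \<Longrightarrow> 2 * M0 \<le> M \<Longrightarrow>
      M \<le> M_max \<Longrightarrow> 3 ^ 8 * L_const f M x g ^ 4 * beta_const f M x g / (2 * M) \<le> C"
    by (rule failure_threshold_bound) blast
  \<comment> \<open>Obtained by solving C (7/\<epsilon>)^4 <= (6/5)^n for n, hence of order |log
    \<epsilon>|.\<close>
  define n where "n \<epsilon> = nat \<lceil>log (6 / 5) (C * 7 ^ 4) - 4 * log (6 / 5) \<epsilon>\<rceil>" for \<epsilon> :: real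
  \<comment> \<open>Stopping at index n means n + 1 computed minimizers.\<close>
  define K where "K \<epsilon> = Suc (n \<epsilon>)" for \<epsilon> :: real
  have n: "C \<le> (\<epsilon> / 7) ^ 4 * (6 / 5) ^ n \<epsilon>" if \<epsilon>: "0 < \<epsilon>" for \<epsilon> :: real
  proof -
    have "log (6 / 5) (C * 7 ^ 4 / \<epsilon> ^ 4) = log (6 / 5) (C * 7 ^ 4) - 4 * log (6 / 5) \<epsilon>"
      using C \<epsilon> by (subst log_divide) (simp_all add: log_nat_power)
    then have "log (6 / 5) (C * 7 ^ 4 / \<epsilon> ^ 4) \<le> real (n \<epsilon>)"
      unfolding n_def by linarith
    then have "C * 7 ^ 4 / \<epsilon> ^ 4 \<le> (6 / 5) powr real (n \<epsilon>)"
      using C \<epsilon> by (subst (asm) log_le_iff) auto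
    then have "C * 7 ^ 4 / \<epsilon> ^ 4 \<le> (6 / 5) ^ n \<epsilon>"
      by (simp add: powr_realpow)
    then have "C * 7 ^ 4 \<le> (6 / 5) ^ n \<epsilon> * \<epsilon> ^ 4"
      using \<epsilon> by (subst (asm) pos_divide_le_eq) auto
    then show ?thesis
      by (simp add: power_divide field_simps)
  qed
  have cap: "inner_cap \<epsilon> (K \<epsilon>)" if \<epsilon>: "0 < \<epsilon>" for \<epsilon>
    unfolding inner_cap_def
  proof (intro allI impI, elim conjE)
    fix x g :: "real^'n" and M
    assume asm: "norm (x - xstar) \<le> R0" "norm g \<le> g_max" "2 * M0 \<le> M" "M \<le> M_max"
    then have "0 < M" using M0_pos by linarith
    then obtain k \<alpha> where
      "alg1 f \<psi> \<epsilon> x g M (iter M x (Suc k)) \<alpha> (inner_gpsi f \<psi> M x k) (Suc k)" "k \<le> n \<epsilon>"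
      "inner_success f \<psi> \<epsilon> M x k \<and> \<alpha> = 0 \<or> inner_failure f \<psi> M x g k \<and> \<alpha> = 1"
      using alg1_terminates[OF \<epsilon> _ thr[OF asm] n[OF \<epsilon>]] by blast
    then show "\<exists>k \<alpha>. alg1 f \<psi> \<epsilon> x g M (iter M x (Suc k)) \<alpha> (inner_gpsi f \<psi> M x k) (Suc k)
        \<and> Suc k \<le> K \<epsilon> \<and> (inner_success f \<psi> \<epsilon> M x k \<and> \<alpha> = 0 \<or> inner_failure f \<psi> M x g k \<and> \<alpha> = 1)"
      unfolding K_def by (metis Suc_le_mono)
  qed
  define bound where "bound \<epsilon> = nat \<lfloor>real (K \<epsilon>) * calls_bound \<epsilon>\<rfloor>" for \<epsilon>
  have "real (K \<epsilon>) \<le> (\<bar>log (6 / 5) (C * 7 ^ 4)\<bar> + 2) + 4 * \<bar>log (6 / 5) \<epsilon>\<bar>" for \<epsilon>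
    unfolding K_def n_def by linarith
  then have "(\<lambda>\<epsilon>. real (bound \<epsilon>)) \<in> O[at_right 0](\<lambda>\<epsilon>. \<bar>log (6 / 5) \<epsilon>\<bar> * \<epsilon> powr (- 1 / 3))"
    unfolding bound_def by (intro complexity_bigo) auto
  moreover have "\<exists>xbar gbar N. alg2_generates f \<psi> M0 \<epsilon> x0 g0 xbar gbar N \<and> N \<le> bound \<epsilon> \<and>
      gbar \<in> subdifferential (ftilde f \<psi>) xbar \<and> norm gbar \<le> \<epsilon>" if \<epsilon>: "0 < \<epsilon>" for \<epsilon>
    using generates_within[OF \<epsilon> cap[OF \<epsilon>]] unfolding bound_def by (meson le_nat_floor)
  ultimately show ?thesis by blast
qed

end
theorem mainTheorem3:
  fixes f :: "real^'n \<Rightarrow> real" and \<psi> :: "real^'n \<Rightarrow> ereal"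
    and xstar x0 g0 :: "real^'n" and Lf R0 M0 :: real
  assumes f_convex: "convex_on UNIV f"
    and f_diff: "three_times_differentiable f"
    and f_lip: "\<And>x y. norm (D3 f x - D3 f y) \<le> Lf * norm (x - y)"
    and psi_convex: "econvex \<psi>"
    and psi_simple: "simple_for f \<psi>"
    and minimizer: "\<And>x. ftilde f \<psi> xstar \<le> ftilde f \<psi> x"
    and x0_dom: "x0 \<in> eff_dom \<psi>"
    and g0_subgradient: "g0 \<in> subdifferential (ftilde f \<psi>) x0"
    and M0_pos: "M0 > 0"
    and R0_pos: "R0 > 0"
    and level_set: "\<And>x. ftilde f \<psi> x \<le> ftilde f \<psi> x0 \<Longrightarrow> norm (x - xstar) \<le> R0"
  shows "(\<exists>bound :: real \<Rightarrow> nat.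
      (\<lambda>\<epsilon>. real (bound \<epsilon>)) \<in> O[at_right 0](\<lambda>\<epsilon>. \<bar>log (6 / 5) \<epsilon>\<bar> * \<epsilon> powr (- 1 / 3)) \<and>
      (\<forall>\<epsilon>>0. \<exists>xbar gbar N.
          alg2_generates f \<psi> M0 \<epsilon> x0 g0 xbar gbar N \<and> N \<le> bound \<epsilon> \<and>
          gbar \<in> subdifferential (ftilde f \<psi>) xbar \<and>
          min (ereal (norm gbar)) (ftilde f \<psi> xbar - ftilde f \<psi> xstar) \<le> ereal \<epsilon>)) \<and>
    (\<exists>bound :: real \<Rightarrow> nat.
      (\<lambda>\<epsilon>. real (bound \<epsilon>)) \<in> O[at_right 0](\<lambda>\<epsilon>. \<bar>log (6 / 5) \<epsilon>\<bar> * \<epsilon> powr (- 1 / 3)) \<and>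
      (\<forall>\<epsilon>>0. \<exists>xbar gbar N.
          alg2_generates f \<psi> M0 \<epsilon> x0 g0 xbar gbar N \<and> N \<le> bound \<epsilon> \<and>
          gbar \<in> subdifferential (ftilde f \<psi>) xbar \<and>
          norm gbar \<le> \<epsilon>))"
proof -
  interpret tensor_method_problem f Lf \<psi> xstar x0 g0 R0 M0
    by unfold_locales (fact assms)+
  obtain bound :: "real \<Rightarrow> nat" where
    bigo: "(\<lambda>\<epsilon>. real (bound \<epsilon>)) \<in> O[at_right 0](\<lambda>\<epsilon>. \<bar>log (6 / 5) \<epsilon>\<bar> * \<epsilon> powr (- 1 / 3))"
    and gen: "\<forall>\<epsilon>>0. \<exists>xbar gbar N. alg2_generates f \<psi> M0 \<epsilon> x0 g0 xbar gbar N \<and> N \<le> bound \<epsilon> \<and>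
      gbar \<in> subdifferential (ftilde f \<psi>) xbar \<and> norm gbar \<le> \<epsilon>"
    using stationarity_complexity by blast
  \<comment> \<open>A small subgradient already makes the minimum small, so both assertions share
    one bound.\<close>
  have "\<forall>\<epsilon>>0. \<exists>xbar gbar N. alg2_generates f \<psi> M0 \<epsilon> x0 g0 xbar gbar N \<and> N \<le> bound \<epsilon> \<and>
      gbar \<in> subdifferential (ftilde f \<psi>) xbar \<and>
      min (ereal (norm gbar)) (ftilde f \<psi> xbar - ftilde f \<psi> xstar) \<le> ereal \<epsilon>"
    using gen by (metis ereal_less_eq(3) min.coboundedI1)
  with bigo gen show ?thesis by blast
qed

end
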